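(* Let $r\ge1$ be an integer and let $\mathcal P$ be a finite family of functions $P:\mathbb R\to\mathbb R$, each satisfying the initial assumptions (A1)--(A3) of the context, with distinct orbits in the sense that $$\varepsilon_{\gamma_1,P_1}P_1^{\gamma_1}\neq\varepsilon_{\gamma_2,P_2}P_2^{\gamma_2}\qquad\text{for all } P_1\ne P_2\in\mathcal P \text{ and all }\gamma_1,\gamma_2\in\Gamma=PGL_2(\mathbb Z).$$ (a) For each $P\in\mathcal P$ let $\lambda_P:\Gamma\times\mathbb R\to[0,\infty)$ satisfy (C), (1), (2), (3) of the context. Then the function $$T(x)=\sum_{P\in\mathcal P}\ \sum_{\gamma\in\Gamma}\lambda_P(\gamma,x)\bigl(\varepsilon_{\gamma,P}P^\gamma\bigr)_+(x)$$ is $1$-periodic and continuous on $\mathbb R$. (b) For each $P\in\mathcal P$ let $\lambda_P:(\Gamma_P\backslash\Gamma)\times\mathbb R\to[0,\infty)$ satisfy (C'), (1'), (3') of the context. Then the function $$T(x)=\sum_{P\in\mathcal P}\ \sum_{\overline\gamma\in\Gamma_P\backslash\Gamma}\lambda_P(\overline\gamma,x)\bigl(P_{\overline\gamma}\bigr)_+(x)$$ is $1$-periodic and continuous on $\mathbb R$.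
   Context: Initial assumptions on $P$ (for a fixed integer $r\ge1$): (A1) $P:\mathbb R\to\mathbb R$ is continuous and piecewise polynomial, with each polynomial piece of degree at most $2r$. (A2) $P$ has exactly two real roots $\alpha<\beta$, both irrational, with $P(x)>0$ for $x\in(\alpha,\beta)$ and $P(x)<0$ for $x\notin[\alpha,\beta]$. (A3) There exists $L<0$ such that $\lim_{x\to-\infty}P(x)/x^{2r}=\lim_{x\to+\infty}P(x)/x^{2r}=L$. Action. For $\gamma=\begin{pmatrix}a&b\\c&d\end{pmatrix}\in\Gamma=PGL_2(\mathbb Z)$ (acting by Möbius transformations $\gamma x=\frac{ax+b}{cx+d}$), put $P^\gamma(x)=(cx+d)^{2r}P\left(\frac{ax+b}{cx+d}\right)$, with the value at the pole $x=-d/c$ (if $c\ne0$) defined by continuity (the limit exists by (A3)). Write $P^\gamma(\infty)$ for $\lim_{x\to\pm\infty}P^\gamma(x)/x^{2r}$ (the "leading coefficient", nonzero because the roots of $P$ are irrational), and let $\varepsilon_{\gamma,P}=1$ if $P^\gamma(\infty)<0$ and $\varepsilon_{\gamma,P}=-1$ if $P^\gamma(\infty)>0$. Let $\Gamma_P=\{\gamma\in\Gamma:\varepsilon_{\gamma,P}P^\gamma\equiv P\}$, a subgroup of $\Gamma$. The function $\varepsilon_{\gamma,P}P^\gamma$ depends only on the coset $\overline\gamma=\Gamma_P\gamma\in\Gamma_P\backslash\Gamma$, and we set $P_{\overline\gamma}:=\varepsilon_{\gamma,P}P^\gamma$. For a real-valued function $Q$, $Q_+(x):=\max\{Q(x),0\}$.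 Let $\mathsf T(x)=x+1$, $V(x)=-x$, $U(x)=1/x$, regarded as elements of $\Gamma$; $\Gamma$ acts on $\Gamma_P\backslash\Gamma$ by right multiplication. Conditions on weights $\lambda=\lambda_P:\Gamma\times\mathbb R\to[0,\infty)$ for a given $P$: (C) For every $\sigma\in\{\mathsf T,V,U\}$ and $\gamma\in\Gamma$: $\lambda(\gamma\sigma^{-1},\sigma x)=\lambda(\gamma,x)$ for all $x$ with $x,\sigma x\in\mathbb R$. (1) For every $\gamma\in\Gamma$, the function $x\mapsto\lambda(\gamma,x)\varepsilon_{\gamma,P}P^\gamma(x)$ is continuous on $\mathbb R$. (2) For every $\gamma\in\Gamma$, the sum $\sum_{\delta\in\Gamma_P}\lambda(\delta\gamma,x)\,|P^\gamma(x)|$ converges locally uniformly in $x\in\mathbb R$. (3) There are only finitely many cosets $\Gamma_P\gamma\in\Gamma_P\backslash\Gamma$ such that $\varepsilon_{\gamma,P}P^\gamma(0)>0$. Conditions on weights $\lambda=\lambda_P:(\Gamma_P\backslash\Gamma)\times\mathbb R\to[0,\infty)$ for a given $P$: (C') For every $\sigma\in\{\mathsf T,V,U\}$ and $\overline\gamma\in\Gamma_P\backslash\Gamma$: $\lambda(\overline\gamma\sigma^{-1},\sigma x)=\lambda(\overline\gamma,x)$ for all $x$ with $x,\sigma x\in\mathbb R$. (1') For every $\overline\gamma\in\Gamma_P\backslash\Gamma$, the function $x\mapsto\lambda(\overline\gamma,x)P_{\overline\gamma}(x)$ is continuous on $\mathbb R$. (3') There are only finitely many cosets $\overline\gamma\in\Gamma_P\backslash\Gamma$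 such that $P_{\overline\gamma}(0)>0$. *)

theory Defs
  imports
    "HOL-Analysis.Analysis"
    "HOL-Computational_Algebra.Polynomial"
    "HOL-Algebra.Coset"
begin

definition piecewise_poly :: "nat \<Rightarrow> (real \<Rightarrow> real) \<Rightarrow> bool" where
  "piecewise_poly n P \<longleftrightarrow>
     (\<exists>S. finite S \<and>
       (\<forall>I \<in> components (- S). \<exists>p. degree p \<le> n \<and> (\<forall>x\<in>I. P x = poly p x)))"

definition initial_assms :: "nat \<Rightarrow> (real \<Rightarrow> real) \<Rightarrow> bool" where
  "initial_assms r P \<longleftrightarrow>
     continuous_on UNIV P \<and> piecewise_poly (2 * r) P \<and>
     (\<exists>\<alpha> \<beta>. \<alpha> < \<beta> \<and> \<alpha> \<notin> \<rat> \<and> \<beta> \<notin> \<rat> \<and> {x. P x = 0} = {\<alpha>, \<beta>} \<and>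
        (\<forall>x\<in>{\<alpha><..<\<beta>}. P x > 0) \<and> (\<forall>x. x \<notin> {\<alpha>..\<beta>} \<longrightarrow> P x < 0)) \<and>
     (\<exists>L<0. ((\<lambda>x. P x / x ^ (2 * r)) \<longlongrightarrow> L) at_bot \<and>
            ((\<lambda>x. P x / x ^ (2 * r)) \<longlongrightarrow> L) at_top)"

definition GL2Z :: "(int ^ 2 ^ 2) monoid" where
  "GL2Z = \<lparr>carrier = {A. invertible A}, mult = (**), one = mat 1\<rparr>"

definition PGL2Z :: "(int ^ 2 ^ 2) set monoid" where
  "PGL2Z = GL2Z Mod {mat 1, - mat 1}"

definition pgl_class :: "int \<Rightarrow> int \<Rightarrow> int \<Rightarrow> int \<Rightarrow> (int ^ 2 ^ 2) set" where
  "pgl_class a b c d = {mat 1, - mat 1} #>\<^bsub>GL2Z\<^esub> vector [vector [a, b], vector [c, d]]"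

definition pgl_T :: "(int ^ 2 ^ 2) set" where "pgl_T = pgl_class 1 1 0 1"
definition pgl_V :: "(int ^ 2 ^ 2) set" where "pgl_V = pgl_class (-1) 0 0 1"
definition pgl_U :: "(int ^ 2 ^ 2) set" where "pgl_U = pgl_class 0 1 1 0"

(* An element of PGL2Z is a pair {A, -A}. The sign of the chosen representative
   flips numer and denom together, so it affects neither moebius nor slash
   (whose weight 2 * r is even). *)
definition rep :: "(int ^ 2 ^ 2) set \<Rightarrow> int ^ 2 ^ 2" where
  "rep \<gamma> = (SOME A. A \<in> \<gamma>)"

definition numer :: "(int ^ 2 ^ 2) set \<Rightarrow> real \<Rightarrow> real" where
  "numer \<gamma> x = of_int (rep \<gamma> $ 1 $ 1) * x + of_int (rep \<gamma> $ 1 $ 2)"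

definition denom :: "(int ^ 2 ^ 2) set \<Rightarrow> real \<Rightarrow> real" where
  "denom \<gamma> x = of_int (rep \<gamma> $ 2 $ 1) * x + of_int (rep \<gamma> $ 2 $ 2)"

(* Meaningful only where denom \<gamma> x is nonzero, that is, where the image of x is not infinity. *)
definition moebius :: "(int ^ 2 ^ 2) set \<Rightarrow> real \<Rightarrow> real" where
  "moebius \<gamma> x = numer \<gamma> x / denom \<gamma> x"

definition slash :: "nat \<Rightarrow> (real \<Rightarrow> real) \<Rightarrow> (int ^ 2 ^ 2) set \<Rightarrow> real \<Rightarrow> real" where
  "slash r P \<gamma> x =
     (let f = (\<lambda>y. denom \<gamma> y ^ (2 * r) * P (moebius \<gamma> y))
      in if denom \<gamma> x = 0 then Lim (at x) f else f x)"

definition slash_infinity :: "nat \<Rightarrow> (real \<Rightarrow> real) \<Rightarrow> (int ^ 2 ^ 2) set \<Rightarrow> real" where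
  "slash_infinity r P \<gamma> = Lim at_infinity (\<lambda>x. slash r P \<gamma> x / x ^ (2 * r))"

(* slash_infinity is never 0 under initial_assms, because the roots of P are irrational. *)
definition eps :: "nat \<Rightarrow> (real \<Rightarrow> real) \<Rightarrow> (int ^ 2 ^ 2) set \<Rightarrow> real" where
  "eps r P \<gamma> = (if slash_infinity r P \<gamma> < 0 then 1 else - 1)"

definition signed_slash :: "nat \<Rightarrow> (real \<Rightarrow> real) \<Rightarrow> (int ^ 2 ^ 2) set \<Rightarrow> real \<Rightarrow> real" where
  "signed_slash r P \<gamma> x = eps r P \<gamma> * slash r P \<gamma> x"

definition stab :: "nat \<Rightarrow> (real \<Rightarrow> real) \<Rightarrow> (int ^ 2 ^ 2) set set" where
  "stab r P = {\<gamma> \<in> carrier PGL2Z. signed_slash r P \<gamma> = P}"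

definition coset_space :: "nat \<Rightarrow> (real \<Rightarrow> real) \<Rightarrow> (int ^ 2 ^ 2) set set set" where
  "coset_space r P = rcosets\<^bsub>PGL2Z\<^esub> (stab r P)"

(* The choice of \<gamma> is immaterial: signed_slash r P is constant on each coset in coset_space r P. *)
definition coset_fun :: "nat \<Rightarrow> (real \<Rightarrow> real) \<Rightarrow> (int ^ 2 ^ 2) set set \<Rightarrow> real \<Rightarrow> real" where
  "coset_fun r P C = signed_slash r P (SOME \<gamma>. \<gamma> \<in> C)"

(* Nets of finite partial sums; as the summands are nonnegative in all uses, this agrees with
   locally uniform convergence of the series along any enumeration of A. *)
definition locally_uniformly_summable :: "('a \<Rightarrow> real \<Rightarrow> real) \<Rightarrow> 'a set \<Rightarrow> bool" where
  "locally_uniformly_summable f A \<longleftrightarrow>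
     (\<forall>x. \<exists>N. open N \<and> x \<in> N \<and>
        (\<exists>l. uniform_limit N (\<lambda>F y. \<Sum>\<delta>\<in>F. f \<delta> y) l (finite_subsets_at_top A)))"

definition group_weight ::
    "nat \<Rightarrow> (real \<Rightarrow> real) \<Rightarrow> ((int ^ 2 ^ 2) set \<Rightarrow> real \<Rightarrow> real) \<Rightarrow> bool" where
  "group_weight r P w \<longleftrightarrow>
     (\<forall>\<gamma>\<in>carrier PGL2Z. \<forall>x. w \<gamma> x \<ge> 0) \<and>
     (\<forall>\<sigma>\<in>{pgl_T, pgl_V, pgl_U}. \<forall>\<gamma>\<in>carrier PGL2Z. \<forall>x. denom \<sigma> x \<noteq> 0 \<longrightarrow>
        w (\<gamma> \<otimes>\<^bsub>PGL2Z\<^esub> inv\<^bsub>PGL2Z\<^esub> \<sigma>) (moebius \<sigma> x) = w \<gamma> x) \<and>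
     (\<forall>\<gamma>\<in>carrier PGL2Z. continuous_on UNIV (\<lambda>x. w \<gamma> x * signed_slash r P \<gamma> x)) \<and>
     (\<forall>\<gamma>\<in>carrier PGL2Z.
        locally_uniformly_summable (\<lambda>\<delta> x. w (\<delta> \<otimes>\<^bsub>PGL2Z\<^esub> \<gamma>) x * \<bar>slash r P \<gamma> x\<bar>) (stab r P)) \<and>
     finite {stab r P #>\<^bsub>PGL2Z\<^esub> \<gamma> | \<gamma>. \<gamma> \<in> carrier PGL2Z \<and> signed_slash r P \<gamma> 0 > 0}"

definition coset_weight ::
    "nat \<Rightarrow> (real \<Rightarrow> real) \<Rightarrow> ((int ^ 2 ^ 2) set set \<Rightarrow> real \<Rightarrow> real) \<Rightarrow> bool" where
  "coset_weight r P w \<longleftrightarrow>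
     (\<forall>C\<in>coset_space r P. \<forall>x. w C x \<ge> 0) \<and>
     (\<forall>\<sigma>\<in>{pgl_T, pgl_V, pgl_U}. \<forall>C\<in>coset_space r P. \<forall>x. denom \<sigma> x \<noteq> 0 \<longrightarrow>
        w (C #>\<^bsub>PGL2Z\<^esub> inv\<^bsub>PGL2Z\<^esub> \<sigma>) (moebius \<sigma> x) = w C x) \<and>
     (\<forall>C\<in>coset_space r P. continuous_on UNIV (\<lambda>x. w C x * coset_fun r P C x)) \<and>
     finite {C \<in> coset_space r P. coset_fun r P C 0 > 0}"

end

theory Submission
  imports Defs
begin

text \<open>
  Consider one function \<open>P\<close> and weights on cosets, and let \<open>T\<close> be its sum. Periodicity is
  a reindexing by the translation \<open>x \<mapsto> x + 1\<close>. Continuity rests on the behaviour of \<open>T\<close> under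
  \<open>x \<mapsto> 1 / x\<close>. Inversion permutes the functions attached to the cosets, except that those which
  are positive at 0 change their sign. A positive part minus the corresponding negative part is the
  function itself, so for nonzero \<open>x\<close>
  \<open>T x = \<phi> x + x\<^sup>2\<^sup>r T (1 / x)\<close>,
  where \<open>\<phi>\<close> is the sum of the weighted functions over the finitely many cosets that are positive
  at 0. Thus \<open>\<phi>\<close> is continuous, and \<open>\<phi> 0 = T 0\<close>.

  This equation yields everything. By periodicity one may assume that the absolute value of \<open>x\<close> is
  at most 1/2, and then \<open>x\<^sup>2\<^sup>r \<le> 1/4\<close>. On rational numbers the Euclidean algorithm ends at 0, where
  the sum is finite; the factor 1/4 gives one bound for all finite partial sums at all rationals
  (\<open>bounded_by_rational\<close>), and by density and continuity of finite sums at all reals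
  (\<open>uniformly_bounded\<close>). So \<open>T\<close> converges and is bounded. Finally, at 0 the equation shows
  continuity since \<open>T\<close> is bounded, and elsewhere it shows that the oscillation of \<open>T\<close> at \<open>x\<close>
  is at most a quarter of the supremum of all oscillations, which must therefore vanish
  (\<open>continuous_of_inversion_equation\<close>).

  The sign rule is found by viewing \<open>P\<close> as a homogeneous function on the plane, for which 0 and
  infinity are points like any others and are exchanged by inversion (\<open>signed_slash_U\<close>).

  Weights on the group are summed over each coset. The sums are weights on cosets: continuity comes
  from locally uniform convergence (\<open>group_weight_local_sum\<close>), the other conditions by reindexing.
  Summing by blocks turns the first part of the theorem into the second.
\<close>

section \<open>Bounded periodic functions with an inversion equation\<close>

text \<open>Every real is an integer translate of a point of the interval from -1/2 to 1/2. This interval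
is where inversion is useful: \<open>x\<^sup>2\<^sup>r\<close> is at most 1/4 there, and inverting a rational number
lowers its denominator.\<close>

lemma periodic_reduction:
  fixes Q :: "real \<Rightarrow> bool"
  assumes per: "\<And>x. Q (x + 1) \<longleftrightarrow> Q x"
    and base: "\<And>x. \<bar>x\<bar> \<le> 1/2 \<Longrightarrow> Q x"
  shows "Q x"
proof -
  have shift: "Q (y + of_int n) \<longleftrightarrow> Q y" for y n
  proof (induction n rule: int_induct[where k = 0])
    case (step1 i)
    then show ?case using per[of "y + of_int i"] by (simp add: add.assoc)
  next
    case (step2 i)
    then show ?case using per[of "y + of_int (i - 1)"] by simp
  qed auto
  have "Q (x - of_int (round x))"
    using of_int_round_abs_le[of x] by (intro base) (simp add: abs_minus_commute)
  with shift[of "x - of_int (round x)" "round x"] show ?thesis by simp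
qed

lemma power_le_quarter:
  fixes x :: real
  assumes "\<bar>x\<bar> \<le> 1/2" "r \<ge> 1"
  shows "x ^ (2 * r) \<le> 1/4"
proof -
  have sq: "x\<^sup>2 \<le> 1/4"
    using power_mono[of "\<bar>x\<bar>" "1/2" 2] assms(1) by (simp add: power2_eq_square)
  have "(x\<^sup>2) ^ r \<le> (x\<^sup>2) ^ 1"
    using sq assms(2) by (intro power_decreasing) auto
  with sq show ?thesis by (simp add: power_mult)
qed

text \<open>The equation expresses the oscillation of \<open>T\<close> at \<open>x\<close> as \<open>x\<^sup>2\<^sup>r\<close> times its oscillation at \<open>1 / x\<close>,
up to contributions of the continuous function \<open>\<phi>\<close>. Since every point can be moved to absolute
value at most 1/2 by periodicity, a bound on the oscillation that holds at all points improves by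
a constant factor, hence arbitrarily often. The point 0, where the equation says nothing, is
treated directly: \<open>T\<close> is bounded, so \<open>x\<^sup>2\<^sup>r T (1 / x)\<close> tends to 0.\<close>

lemma continuous_of_inversion_equation:
  fixes T \<phi> :: "real \<Rightarrow> real"
  assumes r: "r \<ge> 1"
    and bound: "\<And>x. 0 \<le> T x" "\<And>x. T x \<le> B"
    and per: "\<And>x. T (x + 1) = T x"
    and inversion: "\<And>x. x \<noteq> 0 \<Longrightarrow> T x = \<phi> x + x ^ (2 * r) * T (1 / x)"
    and zero: "T 0 = \<phi> 0"
    and cont: "continuous_on UNIV \<phi>"
  shows "continuous_on UNIV T"
proof -
  \<comment> \<open>Adding 1 makes the bound strictly positive, which the error terms below need.\<close>
  define C where "C = B + 1"
  have Cpos: "C > 0" using bound[of 0] by (simp add: C_def)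
  have \<phi>: "(\<phi> \<longlongrightarrow> \<phi> x) (at x)" for x
    using cont by (simp add: continuous_on_eq_continuous_at isCont_def)
  define K where "K n x \<longleftrightarrow> eventually (\<lambda>y. \<bar>T y - T x\<bar> \<le> C / 2 ^ n) (at x)" for n x
  have K_per: "K n (x + 1) \<longleftrightarrow> K n x" for n x
    unfolding K_def at_to_0[of "x + 1"] at_to_0[of x] eventually_filtermap
    using per by (simp add: add.assoc[symmetric])
  have T0: "(T \<longlongrightarrow> T 0) (at 0)"
  proof -
    have "((\<lambda>x. \<phi> x + x ^ (2 * r) * T (1 / x)) \<longlongrightarrow> \<phi> 0 + 0) (at 0)"
    proof (intro tendsto_add \<phi>)
      show "((\<lambda>x. x ^ (2 * r) * T (1 / x)) \<longlongrightarrow> 0) (at 0)"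
      proof (rule Lim_null_comparison)
        show "\<forall>\<^sub>F x in at 0. norm (x ^ (2 * r) * T (1 / x)) \<le> x ^ (2 * r) * C"
          using bound by (intro always_eventually allI)
            (auto simp: abs_mult C_def intro!: mult_left_mono add_increasing2)
        have "((\<lambda>x::real. x ^ (2 * r) * C) \<longlongrightarrow> 0 ^ (2 * r) * C) (at 0)"
          by (intro tendsto_intros)
        moreover have "(0::real) ^ (2 * r) = 0" using r by (intro zero_power) auto
        ultimately show "((\<lambda>x::real. x ^ (2 * r) * C) \<longlongrightarrow> 0) (at 0)" by simp
      qed
    qed
    moreover have "\<forall>\<^sub>F x in at 0. \<phi> x + x ^ (2 * r) * T (1 / x) = T x"
      by (simp add: eventually_at_filter inversion[symmetric])
    ultimately show ?thesis using zero by (simp add: tendsto_cong)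
  qed
  have K_all: "\<forall>x. K n x" for n
  proof (induction n)
    case 0
    have "\<bar>T y - T x\<bar> \<le> C" for x y
      using bound[of x] bound[of y] by (simp add: C_def)
    then show ?case by (simp add: K_def)
  next
    case (Suc n)
    \<comment> \<open>Two errors of this size and a quarter of the old bound add up to half of it.\<close>
    define e where "e = C / 2 ^ n / 8"
    have e: "e > 0" using Cpos by (simp add: e_def)
    show ?case
    proof (rule allI, rule periodic_reduction[where Q = "K (Suc n)"])
      fix x :: real assume x: "\<bar>x\<bar> \<le> 1/2"
      show "K (Suc n) x"
      proof (cases "x = 0")
        case True
        have "\<forall>\<^sub>F y in at 0. dist (T y) (T 0) < C / 2 ^ Suc n"
          using Cpos by (intro tendstoD[OF T0]) auto
        then show ?thesis unfolding K_def True
          by eventually_elim (simp add: dist_real_def)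
      next
        case False
        have ev1: "\<forall>\<^sub>F y in at x. dist (\<phi> y) (\<phi> x) < e"
          by (rule tendstoD[OF \<phi> e])
        have ev2: "\<forall>\<^sub>F y in at x. dist (y ^ (2 * r) * C) (x ^ (2 * r) * C) < e"
          by (rule tendstoD[OF _ e]) (intro tendsto_intros)
        have ev0: "\<forall>\<^sub>F y in at x. y \<noteq> 0"
          using False by (intro tendsto_imp_eventually_ne[where c = x and f = "\<lambda>y. y"] tendsto_ident_at)
        have inv: "filterlim (\<lambda>y. 1 / y) (at (1 / x)) (at x)"
        proof (rule filterlim_atI)
          show "((/) 1 \<longlongrightarrow> 1 / x) (at x)"
            using False by (intro tendsto_intros)
          show "\<forall>\<^sub>F y in at x. 1 / y \<noteq> 1 / x"
            by (auto simp: eventually_at_filter)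
        qed
        have "K n (1 / x)" using Suc by simp
        then have ev3: "\<forall>\<^sub>F y in at x. \<bar>T (1 / y) - T (1 / x)\<bar> \<le> C / 2 ^ n"
          unfolding K_def using inv by (rule eventually_compose_filterlim)
        show ?thesis unfolding K_def using ev0 ev1 ev2 ev3
        proof eventually_elim
          case (elim y)
          have "T y - T x = (\<phi> y - \<phi> x) + (y ^ (2 * r) - x ^ (2 * r)) * T (1 / y)
              + x ^ (2 * r) * (T (1 / y) - T (1 / x))"
            by (subst inversion[OF elim(1)], subst inversion[OF False]) (simp add: algebra_simps)
          also have "\<bar>\<dots>\<bar> \<le> \<bar>\<phi> y - \<phi> x\<bar> + \<bar>(y ^ (2 * r) - x ^ (2 * r)) * T (1 / y)\<bar>
              + \<bar>x ^ (2 * r) * (T (1 / y) - T (1 / x))\<bar>"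
            by linarith
          also have "\<dots> \<le> e + e + 1/4 * (C / 2 ^ n)"
          proof (intro add_mono)
            show "\<bar>\<phi> y - \<phi> x\<bar> \<le> e" using elim(2) by (simp add: dist_real_def)
            have "\<bar>(y ^ (2 * r) - x ^ (2 * r)) * T (1 / y)\<bar> \<le> \<bar>y ^ (2 * r) - x ^ (2 * r)\<bar> * C"
              using bound[of "1 / y"] by (auto simp: abs_mult C_def intro!: mult_left_mono)
            also have "\<dots> = \<bar>y ^ (2 * r) * C - x ^ (2 * r) * C\<bar>"
              using Cpos by (simp add: abs_mult flip: left_diff_distrib)
            also have "\<dots> \<le> e" using elim(3) by (simp add: dist_real_def)
            finally show "\<bar>(y ^ (2 * r) - x ^ (2 * r)) * T (1 / y)\<bar> \<le> e" .
            show "\<bar>x ^ (2 * r) * (T (1 / y) - T (1 / x))\<bar> \<le> 1/4 * (C / 2 ^ n)"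
              unfolding abs_mult using elim(4) power_le_quarter[OF x r]
              by (intro mult_mono) (auto simp: abs_if)
          qed
          also have "\<dots> = C / 2 ^ Suc n" by (simp add: e_def)
          finally show ?case .
        qed
      qed
    qed (rule K_per)
  qed
  have "(T \<longlongrightarrow> T x) (at x)" for x
  proof (rule tendstoI)
    fix e :: real assume "e > 0"
    obtain n where n: "C / e < 2 ^ n"
      using real_arch_pow[of 2 "C / e"] by auto
    have "\<forall>\<^sub>F y in at x. \<bar>T y - T x\<bar> \<le> C / 2 ^ n"
      using K_all[of n] by (simp add: K_def)
    then show "\<forall>\<^sub>F y in at x. dist (T y) (T x) < e"
    proof eventually_elim
      case (elim y)
      also have "C / 2 ^ n < e" using n \<open>e > 0\<close> by (simp add: field_simps)
      finally show ?case by (simp add: dist_real_def)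
    qed
  qed
  then show ?thesis by (simp add: continuous_on_eq_continuous_at isCont_def)
qed

section \<open>Sums of positive parts permuted by translation and inversion\<close>

text \<open>The situation to which the theorem reduces: the functions \<open>G i\<close> are permuted by
\<open>x \<mapsto> x + 1\<close>, and by \<open>x \<mapsto> 1 / x\<close> up to a sign that is negative exactly when the image
index lies in the finite set \<open>Z\<close>. For positive parts this sign means that
\<open>max y 0 - max (- y) 0 = y\<close> measures the failure of invariance, so the sum \<open>total\<close> of the
positive parts fails to be invariant only by the finite sum of \<open>G i\<close> over \<open>Z\<close>.\<close>

locale inversion_family =
  fixes r :: nat and I Z :: "'i set" and G :: "'i \<Rightarrow> real \<Rightarrow> real" and \<tau> \<upsilon> :: "'i \<Rightarrow> 'i"
  assumes r: "r \<ge> 1"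
    and finite_Z: "finite Z" and Z_subset: "Z \<subseteq> I"
    and cont: "\<And>i. i \<in> I \<Longrightarrow> continuous_on UNIV (G i)"
    and bij_\<tau>: "bij_betw \<tau> I I" and bij_\<upsilon>: "bij_betw \<upsilon> I I"
    and translate: "\<And>i x. i \<in> I \<Longrightarrow> G i (x + 1) = G (\<tau> i) x"
    and invert: "\<And>i x. i \<in> I \<Longrightarrow> x \<noteq> 0 \<Longrightarrow>
      x ^ (2 * r) * G i (1 / x) = (if \<upsilon> i \<in> Z then - 1 else 1) * G (\<upsilon> i) x"
    and at_0_Z: "\<And>i. i \<in> Z \<Longrightarrow> G i 0 \<ge> 0"
    and at_0: "\<And>i. i \<in> I - Z \<Longrightarrow> G i 0 \<le> 0"
begin

definition pos where "pos i x = max (G i x) 0"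

definition total where "total x = (\<Sum>\<^sub>\<infinity>i\<in>I. pos i x)"

lemma pos_nonneg [simp]: "pos i x \<ge> 0"
  by (simp add: pos_def)

lemma pos_at_0: "i \<in> I - Z \<Longrightarrow> pos i 0 = 0"
  using at_0[of i] by (simp add: pos_def)

lemma cont_pos: "i \<in> I \<Longrightarrow> continuous_on UNIV (pos i)"
  unfolding pos_def by (intro continuous_intros cont)

lemma pos_translate: "i \<in> I \<Longrightarrow> pos i (x + 1) = pos (\<tau> i) x"
  by (simp add: pos_def translate)

lemma pos_invert:
  assumes "i \<in> I" "x \<noteq> 0"
  shows "x ^ (2 * r) * pos i (1 / x) = pos (\<upsilon> i) x - (if \<upsilon> i \<in> Z then G (\<upsilon> i) x else 0)"
proof -
  have "x ^ (2 * r) * pos i (1 / x) = max (x ^ (2 * r) * G i (1 / x)) 0"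
    using max_mult_distrib_left[of "x ^ (2 * r)" "G i (1 / x)" 0] by (simp add: pos_def)
  then show ?thesis using invert[OF assms] by (auto simp: pos_def)
qed

definition bounded_by :: "real \<Rightarrow> real \<Rightarrow> bool" where
  "bounded_by B x \<longleftrightarrow> (\<forall>F. finite F \<longrightarrow> F \<subseteq> I \<longrightarrow> (\<Sum>i\<in>F. pos i x) \<le> B)"

lemma bounded_by_translate: "bounded_by B (x + 1) \<longleftrightarrow> bounded_by B x"
proof
  assume L: "bounded_by B (x + 1)"
  show "bounded_by B x" unfolding bounded_by_def
  proof (intro allI impI)
    fix F assume F: "finite F" "F \<subseteq> I"
    then obtain F' where F': "F' \<subseteq> I" "finite F'" "F = \<tau> ` F'"
      using bij_\<tau> by (metis bij_betw_imp_surj_on finite_subset_image)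
    have "inj_on \<tau> F'" using F' bij_\<tau> by (meson bij_betw_def inj_on_subset)
    then have "(\<Sum>i\<in>F. pos i x) = (\<Sum>i\<in>F'. pos (\<tau> i) x)"
      using F' by (simp add: sum.reindex)
    also have "\<dots> = (\<Sum>i\<in>F'. pos i (x + 1))"
      using F' by (intro sum.cong) (auto simp: pos_translate)
    finally show "(\<Sum>i\<in>F. pos i x) \<le> B" using L F' by (simp add: bounded_by_def)
  qed
next
  assume R: "bounded_by B x"
  show "bounded_by B (x + 1)" unfolding bounded_by_def
  proof (intro allI impI)
    fix F assume F: "finite F" "F \<subseteq> I"
    have "inj_on \<tau> F" using F bij_\<tau> by (meson bij_betw_def inj_on_subset)
    then have "(\<Sum>i\<in>F. pos i (x + 1)) = (\<Sum>i\<in>\<tau> ` F. pos i x)"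
      using F by (simp add: sum.reindex subset_iff pos_translate)
    moreover have "\<tau> ` F \<subseteq> I" using F bij_\<tau> by (auto simp: bij_betw_def)
    ultimately show "(\<Sum>i\<in>F. pos i (x + 1)) \<le> B" using R F by (simp add: bounded_by_def)
  qed
qed

text \<open>The choice of the bound \<open>2 * M\<close> makes it reproduce itself: the indices in \<open>Z\<close> contribute at
most \<open>M\<close>, all the others at most a quarter of \<open>2 * M\<close> because inversion scales them
by \<open>x\<^sup>2\<^sup>r\<close>.\<close>

lemma bounded_by_invert:
  assumes x: "\<bar>x\<bar> \<le> 1/2" "x \<noteq> 0"
    and M: "(\<Sum>i\<in>Z. pos i x) \<le> M" "M \<ge> 0"
    and b: "bounded_by (2 * M) (1 / x)"
  shows "bounded_by (2 * M) x"
  unfolding bounded_by_def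
proof (intro allI impI)
  fix F assume F: "finite F" "F \<subseteq> I"
  then have "\<exists>F'\<subseteq>I. finite F' \<and> F - Z = \<upsilon> ` F'"
    using bij_\<upsilon> by (intro finite_subset_image) (auto simp: bij_betw_def)
  then obtain F' where F': "F' \<subseteq> I" "finite F'" "F - Z = \<upsilon> ` F'"
    by blast
  have inj: "inj_on \<upsilon> F'" using F' bij_\<upsilon> by (meson bij_betw_def inj_on_subset)
  have "(\<Sum>i\<in>F. pos i x) = (\<Sum>i\<in>F \<inter> Z. pos i x) + (\<Sum>i\<in>F - Z. pos i x)"
    using F by (simp add: sum.Int_Diff)
  also have "(\<Sum>i\<in>F \<inter> Z. pos i x) \<le> M"
    using sum_mono2[of Z "F \<inter> Z" "\<lambda>i. pos i x"] finite_Z M by simp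
  also have "(\<Sum>i\<in>F - Z. pos i x) = (\<Sum>i\<in>F'. pos (\<upsilon> i) x)"
    using F' inj by (simp add: sum.reindex)
  also have "\<dots> = (\<Sum>i\<in>F'. x ^ (2 * r) * pos i (1 / x))"
    using F' x by (intro sum.cong) (auto simp: pos_invert subset_iff)
  also have "\<dots> = x ^ (2 * r) * (\<Sum>i\<in>F'. pos i (1 / x))"
    by (simp add: sum_distrib_left)
  also have "\<dots> \<le> 1/4 * (2 * M)"
    using b F' power_le_quarter[OF x(1) r]
    by (intro mult_mono) (auto simp: bounded_by_def intro!: sum_nonneg)
  finally show "(\<Sum>i\<in>F. pos i x) \<le> 2 * M" using M by simp
qed

text \<open>The Euclidean algorithm: translating and inverting lowers the denominator until the argument
is 0, where only the indices in \<open>Z\<close> contribute. Working with finite partial sums avoids any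
convergence assumption at this stage.\<close>

lemma bounded_by_rational:
  assumes M: "\<And>x. \<bar>x\<bar> \<le> 1/2 \<Longrightarrow> (\<Sum>i\<in>Z. pos i x) \<le> M" "M \<ge> 0" and q: "q > 0"
  shows "bounded_by (2 * M) (of_int p / of_nat q)"
  using q
proof (induction q arbitrary: p rule: less_induct)
  case (less q)
  define Q where "Q x \<longleftrightarrow> (x * of_nat q \<in> \<int> \<longrightarrow> bounded_by (2 * M) x)" for x :: real
  have "Q (of_int p / of_nat q)"
  proof (rule periodic_reduction)
    fix x :: real
    have "(x + 1) * of_nat q \<in> \<int> \<longleftrightarrow> x * of_nat q \<in> \<int>"
      by (metis Ints_add Ints_diff Ints_of_nat add_diff_cancel distrib_right mult_1)
    then show "Q (x + 1) \<longleftrightarrow> Q x" by (simp add: Q_def bounded_by_translate)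
  next
    fix x :: real assume x: "\<bar>x\<bar> \<le> 1/2"
    show "Q x" unfolding Q_def
    proof
      assume "x * of_nat q \<in> \<int>"
      then obtain p where p: "x * of_nat q = of_int p" by (auto elim: Ints_cases)
      show "bounded_by (2 * M) x"
      proof (cases "x = 0")
        case True
        show ?thesis unfolding bounded_by_def True
        proof (intro allI impI)
          fix F assume F: "finite F" "F \<subseteq> I"
          have "(\<Sum>i\<in>F. pos i 0) = (\<Sum>i\<in>F \<inter> Z. pos i 0)"
            using F pos_at_0 by (intro sum.mono_neutral_right) auto
          also have "\<dots> \<le> (\<Sum>i\<in>Z. pos i 0)"
            using finite_Z by (intro sum_mono2) auto
          also have "\<dots> \<le> M" by (intro M) simp
          finally show "(\<Sum>i\<in>F. pos i 0) \<le> 2 * M" using M(2) by simp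
        qed
      next
        case False
        have p0: "p \<noteq> 0" using p False less.prems by auto
        have "\<bar>of_int p :: real\<bar> = \<bar>x\<bar> * of_nat q" using p by (metis abs_mult abs_of_nat)
        also have "\<dots> \<le> 1/2 * of_nat q" using x by (intro mult_right_mono) auto
        also have "\<dots> < of_nat q" using less.prems by simp
        finally have "\<bar>real_of_int p\<bar> < real q" .
        then have small: "nat \<bar>p\<bar> < q" by linarith
        \<comment> \<open>The sign of \<open>p\<close> moves to the numerator, as denominators are natural numbers.\<close>
        have "1 / x = of_nat q / of_int p" using p False p0 by (simp add: field_simps)
        also have "\<dots> = of_int (sgn p * int q) / of_nat (nat \<bar>p\<bar>)"
          using p0 by (cases "p > 0") (auto simp: sgn_if)
        finally have "bounded_by (2 * M) (1 / x)"
          using less.IH[OF small, of "sgn p * int q"] p0 by simp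
        then show ?thesis by (rule bounded_by_invert[OF x False M(1)[OF x] M(2)])
      qed
    qed
  qed
  then show ?case using less.prems by (simp add: Q_def)
qed

text \<open>A finite partial sum is continuous, so its bound on the rationals holds everywhere. At irrational
points infinitely many terms may be nonzero, and this is how summability is obtained there.\<close>

lemma uniformly_bounded: "\<exists>B. \<forall>x. bounded_by B x"
proof -
  have "continuous_on {- 1/2..1/2} (\<lambda>x. \<Sum>i\<in>Z. pos i x)"
    using Z_subset by (intro continuous_on_sum continuous_on_subset[OF cont_pos]) auto
  then have "bounded ((\<lambda>x. \<Sum>i\<in>Z. pos i x) ` {- 1/2..1/2})"
    by (intro compact_imp_bounded compact_continuous_image) auto
  then obtain M where M: "\<And>x. x \<in> {- 1/2..1/2} \<Longrightarrow> \<bar>\<Sum>i\<in>Z. pos i x\<bar> \<le> M"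
    unfolding bounded_iff by (metis imageI real_norm_def)
  have M0: "M \<ge> 0" using M[of 0] by auto
  have M': "(\<Sum>i\<in>Z. pos i x) \<le> M" if "\<bar>x\<bar> \<le> 1/2" for x
    using that by (intro order_trans[OF abs_ge_self M]) (auto simp: abs_le_iff)
  have rat: "bounded_by (2 * M) x" if "x \<in> \<rat>" for x
  proof -
    obtain p q where "q > 0" "x = of_int p / of_int q"
      using \<open>x \<in> \<rat>\<close> by (rule Rats_cases')
    then show ?thesis using bounded_by_rational[OF M' M0, of "nat q" p] by simp
  qed
  have "bounded_by (2 * M) x" for x
    unfolding bounded_by_def
  proof (intro allI impI)
    fix F assume F: "finite F" "F \<subseteq> I"
    have "closed {x. (\<Sum>i\<in>F. pos i x) \<le> 2 * M}"
      using F by (intro closed_Collect_le continuous_on_sum cont_pos continuous_on_const) auto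
    moreover have "\<rat> \<subseteq> {x. (\<Sum>i\<in>F. pos i x) \<le> 2 * M}"
      using rat F by (auto simp: bounded_by_def)
    ultimately have "closure \<rat> \<subseteq> {x. (\<Sum>i\<in>F. pos i x) \<le> 2 * M}"
      by (rule closure_minimal[rotated])
    then show "(\<Sum>i\<in>F. pos i x) \<le> 2 * M"
      by (auto simp: Rats_closure_real)
  qed
  then show ?thesis by blast
qed

lemma summable: "(\<lambda>i. pos i x) summable_on I"
proof -
  obtain B where "\<forall>x. bounded_by B x" using uniformly_bounded by blast
  then show ?thesis
    by (intro nonneg_bdd_above_summable_on bdd_aboveI2[where M = B]) (auto simp: bounded_by_def)
qed

lemma total_periodic: "total (x + 1) = total x"
proof -
  have "total (x + 1) = (\<Sum>\<^sub>\<infinity>i\<in>I. pos (\<tau> i) x)"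
    unfolding total_def by (intro infsum_cong pos_translate)
  also have "\<dots> = total x"
    unfolding total_def by (rule infsum_reindex_bij_betw[OF bij_\<tau>])
  finally show ?thesis .
qed

text \<open>After reindexing, the term of the inverted sum at \<open>i \<in> Z\<close> is the negative part of \<open>G i\<close> in place of its
positive part; the difference of the two is \<open>G i\<close> itself.\<close>

lemma total_invert:
  assumes "x \<noteq> 0"
  shows "total x = (\<Sum>i\<in>Z. G i x) + x ^ (2 * r) * total (1 / x)"
proof -
  define g where "g i = (if i \<in> Z then G i x else 0)" for i
  have g_sum: "(g has_sum (\<Sum>i\<in>Z. G i x)) I"
    by (rule has_sum_finite_neutralI[OF finite_Z Z_subset]) (auto simp: g_def)
  have "x ^ (2 * r) * total (1 / x) = (\<Sum>\<^sub>\<infinity>i\<in>I. x ^ (2 * r) * pos i (1 / x))"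
    unfolding total_def by (rule infsum_cmult_right'[symmetric])
  also have "\<dots> = (\<Sum>\<^sub>\<infinity>i\<in>I. pos (\<upsilon> i) x - g (\<upsilon> i))"
    using assms by (intro infsum_cong) (simp add: pos_invert g_def)
  also have "\<dots> = (\<Sum>\<^sub>\<infinity>i\<in>I. pos i x - g i)"
    by (rule infsum_reindex_bij_betw[OF bij_\<upsilon>])
  also have "\<dots> = total x - (\<Sum>i\<in>Z. G i x)"
    unfolding total_def
    using has_sum_add[OF has_sum_infsum[OF summable] has_sum_uminusI[OF g_sum]]
    by (intro infsumI) simp
  finally show ?thesis by simp
qed

lemma total_0: "total 0 = (\<Sum>i\<in>Z. G i 0)"
proof -
  have "total 0 = (\<Sum>\<^sub>\<infinity>i\<in>Z. pos i 0)"
    unfolding total_def using pos_at_0 Z_subset by (intro infsum_cong_neutral) auto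
  also have "\<dots> = (\<Sum>i\<in>Z. G i 0)"
    using finite_Z at_0_Z by (simp add: pos_def max_absorb1)
  finally show ?thesis .
qed

theorem total_continuous: "continuous_on UNIV total"
proof -
  obtain B where B: "\<And>x. bounded_by B x" using uniformly_bounded by blast
  show ?thesis
  proof (rule continuous_of_inversion_equation[where r = r and B = B and \<phi> = "\<lambda>x. \<Sum>i\<in>Z. G i x"])
    show "continuous_on UNIV (\<lambda>x. \<Sum>i\<in>Z. G i x)"
      using Z_subset by (intro continuous_on_sum cont) auto
    show "total x \<le> B" for x
      unfolding total_def using B[of x] summable
      by (intro infsum_le_finite_sums) (auto simp: bounded_by_def)
    show "total x \<ge> 0" for x
      unfolding total_def by (intro infsum_nonneg) simp
  qed (fact r total_periodic total_invert total_0)+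
qed

end


section \<open>The group of integer matrices modulo sign\<close>

lemma matrix_mult_minus_left: "(- A) ** B = - (A ** (B :: int ^ 2 ^ 2))"
  by (simp add: matrix_matrix_mult_def vec_eq_iff sum_negf)

lemma matrix_mult_minus_right: "A ** (- B) = - (A ** (B :: int ^ 2 ^ 2))"
  by (simp add: matrix_matrix_mult_def vec_eq_iff sum_negf)

lemma group_GL2Z: "group GL2Z"
proof (rule groupI)
  fix A B assume "A \<in> carrier GL2Z" "B \<in> carrier GL2Z"
  then show "A \<otimes>\<^bsub>GL2Z\<^esub> B \<in> carrier GL2Z"
    by (simp add: GL2Z_def invertible_mult)
next
  show "\<one>\<^bsub>GL2Z\<^esub> \<in> carrier GL2Z"
    by (auto simp: GL2Z_def invertible_def intro!: exI[of _ "mat 1"])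
next
  fix A assume "A \<in> carrier GL2Z"
  then show "\<exists>B\<in>carrier GL2Z. B \<otimes>\<^bsub>GL2Z\<^esub> A = \<one>\<^bsub>GL2Z\<^esub>"
    by (auto simp: GL2Z_def invertible_def)
qed (auto simp: GL2Z_def matrix_mul_assoc)

lemma normal_center: "{mat 1, - mat 1} \<lhd> GL2Z"
proof -
  interpret group GL2Z by (rule group_GL2Z)
  have minus: "- A \<in> carrier GL2Z" if A: "A \<in> carrier GL2Z" for A
  proof -
    obtain B where "A ** B = mat 1" "B ** A = mat 1"
      using A by (auto simp: GL2Z_def invertible_def)
    then have "(- A) ** (- B) = mat 1" "(- B) ** (- A) = mat 1"
      by (simp_all add: matrix_mult_minus_left matrix_mult_minus_right)
    then show ?thesis by (auto simp: GL2Z_def invertible_def)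
  qed
  have inv_minus: "inv\<^bsub>GL2Z\<^esub> (- mat 1) = - mat 1"
    by (rule inv_equality)
      (use minus[OF one_closed] in \<open>auto simp: GL2Z_def matrix_mult_minus_left matrix_mult_minus_right\<close>)
  have sub: "subgroup {mat 1, - mat 1} GL2Z"
  proof (rule subgroupI)
    show "{mat 1, - mat 1} \<subseteq> carrier GL2Z"
      using one_closed minus[OF one_closed] by (auto simp: GL2Z_def)
    show "inv\<^bsub>GL2Z\<^esub> A \<in> {mat 1, - mat 1}" if "A \<in> {mat 1, - mat 1}" for A
      using that inv_minus inv_one by (auto simp: GL2Z_def)
  qed (auto simp: GL2Z_def matrix_mult_minus_left matrix_mult_minus_right)
  show ?thesis
    by (rule normalI[OF sub])
      (auto simp: r_coset_def l_coset_def GL2Z_def matrix_mult_minus_left matrix_mult_minus_right)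
qed

interpretation PGL: group PGL2Z
  unfolding PGL2Z_def by (rule normal.factorgroup_is_group[OF normal_center])

lemma center_coset: "{mat 1, - mat 1} #>\<^bsub>GL2Z\<^esub> A = {A, - A}"
  by (auto simp: r_coset_def GL2Z_def matrix_mult_minus_left)

lemma carrier_PGL2Z: "carrier PGL2Z = (\<lambda>A. {A, - A}) ` {A. invertible A}"
  unfolding PGL2Z_def carrier_FactGroup center_coset by (simp add: GL2Z_def)

lemma PGL2Z_mult:
  assumes "\<gamma> \<in> carrier PGL2Z" "\<delta> \<in> carrier PGL2Z" "A \<in> \<gamma>" "B \<in> \<delta>"
  shows "A ** B \<in> \<gamma> \<otimes>\<^bsub>PGL2Z\<^esub> \<delta>"
  using assms by (auto simp: PGL2Z_def set_mult_def GL2Z_def)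

lemma rep_in: "\<gamma> \<in> carrier PGL2Z \<Longrightarrow> rep \<gamma> \<in> \<gamma>"
  unfolding rep_def carrier_PGL2Z by (rule someI_ex) auto

lemma PGL2Z_elem_cases:
  assumes "\<gamma> \<in> carrier PGL2Z" "A \<in> \<gamma>" "B \<in> \<gamma>"
  shows "B = A \<or> B = - A"
  using assms by (auto simp: carrier_PGL2Z)

lemma PGL2Z_elem_det:
  assumes "\<gamma> \<in> carrier PGL2Z" "A \<in> \<gamma>"
  shows "A $ 1 $ 1 * A $ 2 $ 2 - A $ 1 $ 2 * A $ 2 $ 1 \<noteq> 0"
proof -
  obtain B where B: "invertible B" "A = B \<or> A = - B"
    using assms by (auto simp: carrier_PGL2Z)
  then obtain B' where "B ** B' = mat 1" by (auto simp: invertible_def)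
  then have "det B * det B' = 1" by (metis det_mul det_I)
  then have "det B \<noteq> 0" by auto
  then show ?thesis using B(2) by (auto simp: det_2)
qed

section \<open>The slash action through homogeneous functions\<close>

definition leading :: "nat \<Rightarrow> (real \<Rightarrow> real) \<Rightarrow> real" where
  "leading r P = Lim at_top (\<lambda>x. P x / x ^ (2 * r))"

text \<open>The function \<open>P\<close> corresponds to a homogeneous function of degree \<open>2 * r\<close> of two variables,
continuous away from the origin. In these terms the slash action is substitution of a matrix, and
the values at a pole and at infinity become ordinary values.\<close>

definition homog :: "nat \<Rightarrow> (real \<Rightarrow> real) \<Rightarrow> real \<Rightarrow> real \<Rightarrow> real" where
  "homog r P u v = (if v = 0 then leading r P * u ^ (2 * r) else v ^ (2 * r) * P (u / v))"

lemma homog_scale: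
  assumes "t \<noteq> 0"
  shows "homog r P (t * u) (t * v) = t ^ (2 * r) * homog r P u v"
  using assms by (simp add: homog_def power_mult_distrib)

lemma homog_uminus: "homog r P (- u) (- v) = homog r P u v"
  using homog_scale[of "-1" r P u v] by simp

lemma leading_limit:
  assumes "initial_assms r P"
  shows "leading r P < 0"
    "((\<lambda>x. P x / x ^ (2 * r)) \<longlongrightarrow> leading r P) at_bot"
    "((\<lambda>x. P x / x ^ (2 * r)) \<longlongrightarrow> leading r P) at_top"
proof -
  obtain L where L: "L < 0" "((\<lambda>x. P x / x ^ (2 * r)) \<longlongrightarrow> L) at_bot"
    "((\<lambda>x. P x / x ^ (2 * r)) \<longlongrightarrow> L) at_top"
    using assms unfolding initial_assms_def by blast
  moreover have "leading r P = L"
    unfolding leading_def by (rule tendsto_Lim[OF _ L(3)]) simp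
  ultimately show "leading r P < 0"
    "((\<lambda>x. P x / x ^ (2 * r)) \<longlongrightarrow> leading r P) at_bot"
    "((\<lambda>x. P x / x ^ (2 * r)) \<longlongrightarrow> leading r P) at_top" by simp_all
qed

text \<open>The two-sided limit of \<open>P x / x\<^sup>2\<^sup>r\<close> is exactly continuity at the point at infinity of the
projective line.\<close>

lemma isCont_homog_infinity:
  assumes P: "initial_assms r P"
  shows "isCont (homog r P 1) 0"
proof -
  define L where "L = leading r P"
  have eq: "P (inverse t) / inverse t ^ (2 * r) = homog r P 1 t" if "t \<noteq> 0" for t
    using that by (simp add: homog_def field_simps)
  have "((\<lambda>t. P (inverse t) / inverse t ^ (2 * r)) \<longlongrightarrow> L) (at_left 0)"
    unfolding L_def
    by (rule filterlim_compose[OF leading_limit(2)[OF P] filterlim_inverse_at_bot_neg])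
  then have left: "(homog r P 1 \<longlongrightarrow> L) (at_left 0)"
    by (rule Lim_transform_eventually) (auto simp: eventually_at_filter eq)
  have "((\<lambda>t. P (inverse t) / inverse t ^ (2 * r)) \<longlongrightarrow> L) (at_right 0)"
    unfolding L_def
    by (rule filterlim_compose[OF leading_limit(3)[OF P] filterlim_inverse_at_top_right])
  then have right: "(homog r P 1 \<longlongrightarrow> L) (at_right 0)"
    by (rule Lim_transform_eventually) (auto simp: eventually_at_filter eq)
  from left right have "(homog r P 1 \<longlongrightarrow> L) (at 0)"
    by (rule filterlim_split_at)
  then show ?thesis by (simp add: isCont_def homog_def L_def)
qed

text \<open>Near a point with nonzero second coordinate the chart \<open>f / g\<close> is used, and otherwise the
chart \<open>g / f\<close> around infinity.\<close>

lemma isCont_homog: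
  fixes f g :: "real \<Rightarrow> real"
  assumes P: "initial_assms r P"
    and f: "isCont f x" and g: "isCont g x" and nz: "f x \<noteq> 0 \<or> g x \<noteq> 0"
  shows "isCont (\<lambda>y. homog r P (f y) (g y)) x"
proof (cases "g x = 0")
  case False
  have "isCont (\<lambda>y. f y / g y) x"
    using f g False by (rule isCont_divide)
  moreover have "isCont P (f x / g x)"
    using P by (simp add: initial_assms_def continuous_on_eq_continuous_at)
  ultimately have "isCont (\<lambda>y. P (f y / g y)) x" by (rule isCont_o2)
  then have cont: "isCont (\<lambda>y. g y ^ (2 * r) * P (f y / g y)) x"
    by (intro continuous_mult continuous_power g)
  have "\<forall>\<^sub>F y in at x. g y \<noteq> 0"
    using g False unfolding isCont_def by (rule tendsto_imp_eventually_ne)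
  then have "\<forall>\<^sub>F y in nhds x. g y \<noteq> 0"
    using False by (simp add: eventually_nhds_conv_at)
  then have "\<forall>\<^sub>F y in nhds x. g y ^ (2 * r) * P (f y / g y) = homog r P (f y) (g y)"
    by eventually_elim (simp add: homog_def)
  from isCont_cong[OF this] cont show ?thesis by simp
next
  case True
  with nz have fx: "f x \<noteq> 0" by simp
  have "isCont (\<lambda>y. g y / f y) x"
    using g f fx by (rule isCont_divide)
  moreover have "isCont (homog r P 1) (g x / f x)"
    using isCont_homog_infinity[OF P] True by simp
  ultimately have "isCont (\<lambda>y. homog r P 1 (g y / f y)) x" by (rule isCont_o2)
  then have cont: "isCont (\<lambda>y. f y ^ (2 * r) * homog r P 1 (g y / f y)) x"
    by (intro continuous_mult continuous_power f)
  have "\<forall>\<^sub>F y in at x. f y \<noteq> 0"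
    using f fx unfolding isCont_def by (rule tendsto_imp_eventually_ne)
  then have "\<forall>\<^sub>F y in nhds x. f y \<noteq> 0"
    using fx by (simp add: eventually_nhds_conv_at)
  then have "\<forall>\<^sub>F y in nhds x. f y ^ (2 * r) * homog r P 1 (g y / f y) = homog r P (f y) (g y)"
  proof eventually_elim
    case (elim y)
    then show ?case using homog_scale[of "f y" r P 1 "g y / f y"] by simp
  qed
  from isCont_cong[OF this] cont show ?thesis by simp
qed

text \<open>The roots of \<open>P\<close> are irrational, so no nonzero integer vector lies on a line of zeros. This makes the
signs \<open>eps\<close> meaningful.\<close>

lemma homog_nonzero:
  fixes p q :: int
  assumes P: "initial_assms r P" and nz: "p \<noteq> 0 \<or> q \<noteq> 0"
  shows "homog r P (of_int p) (of_int q) \<noteq> 0"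
proof (cases "q = 0")
  case True
  then show ?thesis using nz leading_limit(1)[OF P] by (simp add: homog_def)
next
  case False
  obtain \<alpha> \<beta> where roots: "\<alpha> \<notin> \<rat>" "\<beta> \<notin> \<rat>" "{x. P x = 0} = {\<alpha>, \<beta>}"
    using P unfolding initial_assms_def by blast
  have "(of_int p / of_int q :: real) \<in> \<rat>" by simp
  with roots(1,2) have "of_int p / of_int q \<notin> {\<alpha>, \<beta>}" by auto
  then have "P (of_int p / of_int q) \<noteq> 0" unfolding roots(3)[symmetric] by simp
  then show ?thesis using False by (simp add: homog_def)
qed

lemma numer_denom_nonzero:
  assumes "\<gamma> \<in> carrier PGL2Z"
  shows "numer \<gamma> x \<noteq> 0 \<or> denom \<gamma> x \<noteq> 0"
proof (rule ccontr)
  define a b c d where "a = rep \<gamma> $ 1 $ 1" "b = rep \<gamma> $ 1 $ 2" "c = rep \<gamma> $ 2 $ 1" "d = rep \<gamma> $ 2 $ 2"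
  note abcd = this
  assume "\<not> ?thesis"
  then have "of_int b = - (of_int a * x)" "of_int d = - (of_int c * x)"
    by (auto simp: numer_def denom_def abcd)
  then have "(of_int (a * d - b * c) :: real) = 0"
    by (simp add: algebra_simps)
  then have "a * d - b * c = 0" by (simp only: of_int_eq_0_iff)
  with PGL2Z_elem_det[OF assms rep_in[OF assms]] show False by (simp add: abcd)
qed

text \<open>At a pole the defining limit is a value of the homogeneous function, by continuity.\<close>

lemma slash_eq_homog:
  assumes P: "initial_assms r P" and \<gamma>: "\<gamma> \<in> carrier PGL2Z"
  shows "slash r P \<gamma> x = homog r P (numer \<gamma> x) (denom \<gamma> x)"
proof -
  define f where "f y = denom \<gamma> y ^ (2 * r) * P (moebius \<gamma> y)" for y
  have f_eq: "f y = homog r P (numer \<gamma> y) (denom \<gamma> y)" if "denom \<gamma> y \<noteq> 0" for y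
    using that by (simp add: f_def homog_def moebius_def)
  have "Lim (at x) f = homog r P (numer \<gamma> x) (denom \<gamma> x)" if x: "denom \<gamma> x = 0"
  proof (rule tendsto_Lim)
    have "isCont (\<lambda>y. homog r P (numer \<gamma> y) (denom \<gamma> y)) x"
      using numer_denom_nonzero[OF \<gamma>]
      by (intro isCont_homog[OF P]) (auto simp: numer_def denom_def intro!: continuous_intros)
    then have "((\<lambda>y. homog r P (numer \<gamma> y) (denom \<gamma> y)) \<longlongrightarrow> homog r P (numer \<gamma> x) (denom \<gamma> x)) (at x)"
      by (simp add: isCont_def)
    moreover have "denom \<gamma> y \<noteq> 0" if "y \<noteq> x" for y
    proof
      assume y: "denom \<gamma> y = 0"
      have "of_int (rep \<gamma> $ 2 $ 1) * (y - x) = denom \<gamma> y - denom \<gamma> x"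
        by (simp add: denom_def algebra_simps)
      with x y have "of_int (rep \<gamma> $ 2 $ 1) * (y - x) = 0" by simp
      with that have "rep \<gamma> $ 2 $ 1 = 0" by simp
      with x have "rep \<gamma> $ 2 $ 2 = 0" by (simp add: denom_def)
      with \<open>rep \<gamma> $ 2 $ 1 = 0\<close> PGL2Z_elem_det[OF \<gamma> rep_in[OF \<gamma>]] show False by simp
    qed
    ultimately show "(f \<longlongrightarrow> homog r P (numer \<gamma> x) (denom \<gamma> x)) (at x)"
      by (elim Lim_transform_eventually) (auto simp: eventually_at_filter f_eq)
  qed simp
  then show ?thesis
    unfolding slash_def Let_def f_def[symmetric] using f_eq by simp
qed

lemma slash_infinity_limit:
  assumes P: "initial_assms r P" and \<gamma>: "\<gamma> \<in> carrier PGL2Z"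
  defines "l \<equiv> homog r P (of_int (rep \<gamma> $ 1 $ 1)) (of_int (rep \<gamma> $ 2 $ 1))"
  shows "((\<lambda>x. slash r P \<gamma> x / x ^ (2 * r)) \<longlongrightarrow> l) at_infinity"
    and "slash_infinity r P \<gamma> = l"
proof -
  \<comment> \<open>Dividing by \<open>x\<^sup>2\<^sup>r\<close> amounts to substituting \<open>(1, t)\<close> for \<open>(x, 1)\<close>, with \<open>t = 1 / x\<close>.\<close>
  define h where "h t = homog r P (of_int (rep \<gamma> $ 1 $ 1) + of_int (rep \<gamma> $ 1 $ 2) * t)
    (of_int (rep \<gamma> $ 2 $ 1) + of_int (rep \<gamma> $ 2 $ 2) * t)" for t
  have "isCont h 0"
    unfolding h_def using PGL2Z_elem_det[OF \<gamma> rep_in[OF \<gamma>]]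
    by (intro isCont_homog[OF P]) (auto intro!: continuous_intros)
  then have "((\<lambda>x. h (inverse x)) \<longlongrightarrow> h 0) at_infinity"
    by (rule isCont_tendsto_compose[OF _ tendsto_inverse_0])
  moreover have "\<forall>\<^sub>F x in at_infinity. h (inverse x) = slash r P \<gamma> x / x ^ (2 * r)"
    using eventually_not_equal_at_infinity[of 0]
  proof eventually_elim
    case (elim x)
    have "x * (p + q * inverse x) = p * x + q" for p q
      using elim by (simp add: field_simps)
    then have "slash r P \<gamma> x = x ^ (2 * r) * h (inverse x)"
      unfolding slash_eq_homog[OF P \<gamma>] h_def homog_scale[OF elim, symmetric]
      by (simp add: numer_def denom_def)
    then show ?case using elim by simp
  qed
  ultimately have "((\<lambda>x. slash r P \<gamma> x / x ^ (2 * r)) \<longlongrightarrow> h 0) at_infinity"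
    by (rule Lim_transform_eventually)
  then show lim: "((\<lambda>x. slash r P \<gamma> x / x ^ (2 * r)) \<longlongrightarrow> l) at_infinity"
    by (simp add: h_def l_def)
  then show "slash_infinity r P \<gamma> = l"
    unfolding slash_infinity_def by (intro tendsto_Lim trivial_limit_at_infinity)
qed

lemma slash_elem_homog:
  assumes P: "initial_assms r P" and \<gamma>: "\<gamma> \<in> carrier PGL2Z" and A: "A \<in> \<gamma>"
  shows "slash r P \<gamma> x = homog r P (of_int (A $ 1 $ 1) * x + of_int (A $ 1 $ 2))
      (of_int (A $ 2 $ 1) * x + of_int (A $ 2 $ 2))" (is "_ = homog r P ?u ?v")
    and "slash_infinity r P \<gamma> = homog r P (of_int (A $ 1 $ 1)) (of_int (A $ 2 $ 1))"
proof -
  have "rep \<gamma> = A \<or> rep \<gamma> = - A" by (rule PGL2Z_elem_cases[OF \<gamma> A rep_in[OF \<gamma>]])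
  then have nd: "numer \<gamma> x = ?u \<and> denom \<gamma> x = ?v \<or> numer \<gamma> x = - ?u \<and> denom \<gamma> x = - ?v"
    by (elim disjE) (simp_all add: numer_def denom_def)
  then show "slash r P \<gamma> x = homog r P ?u ?v"
    unfolding slash_eq_homog[OF P \<gamma>] by (elim disjE conjE) (simp_all only: homog_uminus)
  have "rep \<gamma> $ 1 $ 1 = A $ 1 $ 1 \<and> rep \<gamma> $ 2 $ 1 = A $ 2 $ 1 \<or>
      rep \<gamma> $ 1 $ 1 = - (A $ 1 $ 1) \<and> rep \<gamma> $ 2 $ 1 = - (A $ 2 $ 1)"
    using \<open>rep \<gamma> = A \<or> rep \<gamma> = - A\<close> by (elim disjE) simp_all
  then show "slash_infinity r P \<gamma> = homog r P (of_int (A $ 1 $ 1)) (of_int (A $ 2 $ 1))"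
    unfolding slash_infinity_limit(2)[OF P \<gamma>]
    by (elim disjE conjE) (simp_all only: of_int_minus homog_uminus)
qed

text \<open>The values of the slashed function on the real line and at infinity together determine all its
further slash transforms.\<close>

lemma slash_mult:
  assumes P: "initial_assms r P" and \<gamma>: "\<gamma> \<in> carrier PGL2Z" and \<delta>: "\<delta> \<in> carrier PGL2Z"
  shows "slash r P (\<gamma> \<otimes>\<^bsub>PGL2Z\<^esub> \<delta>) x =
    (if denom \<delta> x = 0 then numer \<delta> x ^ (2 * r) * slash_infinity r P \<gamma>
     else denom \<delta> x ^ (2 * r) * slash r P \<gamma> (moebius \<delta> x))"
proof -
  define A where "A = rep \<gamma>"
  have A: "A \<in> \<gamma>" unfolding A_def by (rule rep_in[OF \<gamma>])
  define u v where uv: "u = numer \<delta> x" "v = denom \<delta> x"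
  have "slash r P (\<gamma> \<otimes>\<^bsub>PGL2Z\<^esub> \<delta>) x =
    homog r P (of_int ((A ** rep \<delta>) $ 1 $ 1) * x + of_int ((A ** rep \<delta>) $ 1 $ 2))
      (of_int ((A ** rep \<delta>) $ 2 $ 1) * x + of_int ((A ** rep \<delta>) $ 2 $ 2))"
    using \<gamma> \<delta> by (intro slash_elem_homog[OF P] PGL2Z_mult A rep_in) simp_all
  also have "\<dots> = homog r P (of_int (A $ 1 $ 1) * u + of_int (A $ 1 $ 2) * v)
      (of_int (A $ 2 $ 1) * u + of_int (A $ 2 $ 2) * v)" (is "_ = homog r P ?u ?v")
    by (simp add: numer_def denom_def uv matrix_matrix_mult_def sum_2 algebra_simps)
  finally have eq: "slash r P (\<gamma> \<otimes>\<^bsub>PGL2Z\<^esub> \<delta>) x = homog r P ?u ?v" .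
  show ?thesis
  proof (cases "v = 0")
    case True
    then have "u \<noteq> 0" using numer_denom_nonzero[OF \<delta>, of x] by (simp add: uv)
    then show ?thesis
      using True homog_scale[of u r P "of_int (A $ 1 $ 1)" "of_int (A $ 2 $ 1)"]
      by (simp add: eq slash_elem_homog(2)[OF P \<gamma> A] mult.commute flip: uv)
  next
    case False
    have scale: "v * (p * (u / v) + q) = p * u + q * v" for p q
      using False by (simp add: field_simps)
    have "v ^ (2 * r) * slash r P \<gamma> (u / v) = homog r P ?u ?v"
      unfolding slash_elem_homog(1)[OF P \<gamma> A] homog_scale[OF False, symmetric] scale ..
    then show ?thesis using False by (simp add: eq moebius_def flip: uv)
  qed
qed

section \<open>Signs, the stabiliser and its cosets\<close>

lemma slash_infinity_nonzero:
  assumes P: "initial_assms r P" and \<gamma>: "\<gamma> \<in> carrier PGL2Z"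
  shows "slash_infinity r P \<gamma> \<noteq> 0"
  unfolding slash_infinity_limit(2)[OF assms]
  using PGL2Z_elem_det[OF \<gamma> rep_in[OF \<gamma>]] by (intro homog_nonzero[OF P]) auto

lemma eps_eq_sgn:
  assumes "initial_assms r P" "\<gamma> \<in> carrier PGL2Z"
  shows "eps r P \<gamma> = - sgn (slash_infinity r P \<gamma>)"
  using slash_infinity_nonzero[OF assms] by (simp add: eps_def sgn_if)

text \<open>The value at infinity is a limit of values on the real line.\<close>

lemma slash_infinity_proportional:
  assumes P: "initial_assms r P" and \<gamma>: "\<gamma>\<^sub>1 \<in> carrier PGL2Z" "\<gamma>\<^sub>2 \<in> carrier PGL2Z"
    and eq: "\<And>x. c\<^sub>1 * slash r P \<gamma>\<^sub>1 x = c\<^sub>2 * slash r P \<gamma>\<^sub>2 x"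
  shows "c\<^sub>1 * slash_infinity r P \<gamma>\<^sub>1 = c\<^sub>2 * slash_infinity r P \<gamma>\<^sub>2"
proof -
  have lim: "((\<lambda>x. c * (slash r P \<gamma> x / x ^ (2 * r))) \<longlongrightarrow> c * slash_infinity r P \<gamma>) at_infinity"
    if "\<gamma> \<in> carrier PGL2Z" for \<gamma> c
    using slash_infinity_limit[OF P that] by (intro tendsto_mult_left) simp
  have "c\<^sub>1 * (slash r P \<gamma>\<^sub>1 x / x ^ (2 * r)) = c\<^sub>2 * (slash r P \<gamma>\<^sub>2 x / x ^ (2 * r))" for x
    using eq[of x] by (simp only: times_divide_eq_right)
  then show ?thesis
    using lim[OF \<gamma>(1), of c\<^sub>1] lim[OF \<gamma>(2), of c\<^sub>2]
    by (simp only:) (rule tendsto_unique[OF trivial_limit_at_infinity])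
qed

text \<open>The sign of a signed transform is fixed by its own value at infinity. So replacing a
transform by its negative does not affect the signed transforms that further group elements
produce from it. This gives a right action on signed transforms without a formula for \<open>eps\<close> on
products.\<close>

lemma signed_slash_mult_cong:
  assumes P: "initial_assms r P"
    and \<gamma>: "\<gamma>\<^sub>1 \<in> carrier PGL2Z" "\<gamma>\<^sub>2 \<in> carrier PGL2Z" and \<delta>: "\<delta> \<in> carrier PGL2Z"
    and eq: "signed_slash r P \<gamma>\<^sub>1 = signed_slash r P \<gamma>\<^sub>2"
  shows "signed_slash r P (\<gamma>\<^sub>1 \<otimes>\<^bsub>PGL2Z\<^esub> \<delta>) = signed_slash r P (\<gamma>\<^sub>2 \<otimes>\<^bsub>PGL2Z\<^esub> \<delta>)"
proof
  fix x
  let ?e1 = "eps r P \<gamma>\<^sub>1" and ?e2 = "eps r P \<gamma>\<^sub>2"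
  let ?g1 = "\<gamma>\<^sub>1 \<otimes>\<^bsub>PGL2Z\<^esub> \<delta>" and ?g2 = "\<gamma>\<^sub>2 \<otimes>\<^bsub>PGL2Z\<^esub> \<delta>"
  have closed: "?g1 \<in> carrier PGL2Z" "?g2 \<in> carrier PGL2Z" using \<gamma> \<delta> by simp_all
  have eq1: "?e1 * slash r P \<gamma>\<^sub>1 y = ?e2 * slash r P \<gamma>\<^sub>2 y" for y
    using fun_cong[OF eq, of y] by (simp add: signed_slash_def)
  note inf1 = slash_infinity_proportional[OF P \<gamma> eq1]
  have eq2: "?e1 * slash r P ?g1 y = ?e2 * slash r P ?g2 y" for y
    using eq1 inf1 by (simp add: slash_mult[OF P _ \<delta>] \<gamma> mult.left_commute)
  note inf2 = slash_infinity_proportional[OF P closed eq2]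
  have sgn_e: "sgn (eps r P \<gamma>) = eps r P \<gamma>" and ee: "eps r P \<gamma> * eps r P \<gamma> = 1" for \<gamma>
    by (simp_all add: eps_def)
  have "sgn (?e1 * slash_infinity r P ?g1) = sgn (?e2 * slash_infinity r P ?g2)"
    using inf2 by simp
  then have "eps r P ?g1 * ?e1 = eps r P ?g2 * ?e2"
    by (simp add: sgn_mult sgn_e eps_eq_sgn[OF P closed(1)] eps_eq_sgn[OF P closed(2)] mult.commute)
  then have "(eps r P ?g1 * ?e1) * (?e1 * slash r P ?g1 x) = (eps r P ?g2 * ?e2) * (?e2 * slash r P ?g2 x)"
    using eq2[of x] by simp
  moreover have "(a * eps r P \<gamma>) * (eps r P \<gamma> * b) = a * b" for a b \<gamma>
    using ee[of \<gamma>] by (metis mult.assoc mult_1)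
  ultimately show "signed_slash r P ?g1 x = signed_slash r P ?g2 x"
    by (simp add: signed_slash_def)
qed

lemma signed_slash_one:
  assumes P: "initial_assms r P"
  shows "signed_slash r P \<one>\<^bsub>PGL2Z\<^esub> = P"
proof -
  have one: "\<one>\<^bsub>PGL2Z\<^esub> \<in> carrier PGL2Z" by simp
  have mat: "mat 1 \<in> \<one>\<^bsub>PGL2Z\<^esub>" by (simp add: PGL2Z_def)
  have "slash r P \<one>\<^bsub>PGL2Z\<^esub> x = P x" for x
    by (simp add: slash_elem_homog(1)[OF P one mat] homog_def mat_def)
  moreover have "eps r P \<one>\<^bsub>PGL2Z\<^esub> = 1"
    using leading_limit(1)[OF P]
    by (simp add: eps_def slash_elem_homog(2)[OF P one mat] homog_def mat_def)
  ultimately show ?thesis by (simp add: signed_slash_def fun_eq_iff)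
qed

lemma subgroup_stab:
  assumes P: "initial_assms r P"
  shows "subgroup (stab r P) PGL2Z"
proof (rule PGL.subgroupI)
  show "stab r P \<subseteq> carrier PGL2Z" by (auto simp: stab_def)
  show "stab r P \<noteq> {}"
    using signed_slash_one[OF P] PGL.one_closed unfolding stab_def by blast
next
  fix \<gamma> assume \<gamma>: "\<gamma> \<in> stab r P"
  then have carrier: "\<gamma> \<in> carrier PGL2Z" by (simp add: stab_def)
  have "signed_slash r P \<gamma> = signed_slash r P \<one>\<^bsub>PGL2Z\<^esub>"
    using \<gamma> signed_slash_one[OF P] by (simp add: stab_def)
  from signed_slash_mult_cong[OF P carrier _ _ this, of "inv\<^bsub>PGL2Z\<^esub> \<gamma>"]
  have "signed_slash r P (inv\<^bsub>PGL2Z\<^esub> \<gamma>) = P"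
    using carrier signed_slash_one[OF P] by simp
  then show "inv\<^bsub>PGL2Z\<^esub> \<gamma> \<in> stab r P" using carrier by (simp add: stab_def)
next
  fix \<gamma> \<delta> assume \<gamma>: "\<gamma> \<in> stab r P" and \<delta>: "\<delta> \<in> stab r P"
  then have carrier: "\<gamma> \<in> carrier PGL2Z" "\<delta> \<in> carrier PGL2Z" by (simp_all add: stab_def)
  have "signed_slash r P \<gamma> = signed_slash r P \<one>\<^bsub>PGL2Z\<^esub>"
    using \<gamma> signed_slash_one[OF P] by (simp add: stab_def)
  from signed_slash_mult_cong[OF P carrier(1) _ carrier(2) this]
  have "signed_slash r P (\<gamma> \<otimes>\<^bsub>PGL2Z\<^esub> \<delta>) = P"
    using carrier \<delta> by (simp add: stab_def)
  then show "\<gamma> \<otimes>\<^bsub>PGL2Z\<^esub> \<delta> \<in> stab r P" using carrier by (simp add: stab_def)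
qed

lemma signed_slash_stab_mult:
  assumes P: "initial_assms r P" and "\<delta> \<in> stab r P" "\<gamma> \<in> carrier PGL2Z"
  shows "signed_slash r P (\<delta> \<otimes>\<^bsub>PGL2Z\<^esub> \<gamma>) = signed_slash r P \<gamma>"
  using signed_slash_mult_cong[OF P _ PGL.one_closed assms(3), of \<delta>] assms signed_slash_one[OF P]
  by (simp add: stab_def)

lemma coset_fun_eq:
  assumes P: "initial_assms r P" and C: "C \<in> coset_space r P" "\<gamma> \<in> C"
  shows "coset_fun r P C = signed_slash r P \<gamma>"
proof -
  have const: "signed_slash r P \<gamma>' = signed_slash r P \<gamma>" if "\<gamma>' \<in> C" for \<gamma>'
  proof -
    obtain \<gamma>\<^sub>0 where \<gamma>\<^sub>0: "\<gamma>\<^sub>0 \<in> carrier PGL2Z" "C = stab r P #>\<^bsub>PGL2Z\<^esub> \<gamma>\<^sub>0"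
      using C by (auto simp: coset_space_def RCOSETS_def)
    then show ?thesis
      using C(2) that signed_slash_stab_mult[OF P _ \<gamma>\<^sub>0(1)] by (auto simp: r_coset_def)
  qed
  show ?thesis unfolding coset_fun_def by (rule const) (rule someI[of "\<lambda>\<gamma>. \<gamma> \<in> C", OF C(2)])
qed

section \<open>Translation and inversion as group elements\<close>

lemma pgl_class_elems: "pgl_class a b c d =
    {vector [vector [a, b], vector [c, d]], - vector [vector [a, b], vector [c, d]]}"
  unfolding pgl_class_def by (rule center_coset)

lemma matrix2_eqI:
  fixes A B :: "'a ^ 2 ^ 2"
  assumes "A $ 1 $ 1 = B $ 1 $ 1" "A $ 1 $ 2 = B $ 1 $ 2" "A $ 2 $ 1 = B $ 2 $ 1" "A $ 2 $ 2 = B $ 2 $ 2"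
  shows "A = B"
  using assms by (simp add: vec_eq_iff forall_2)

lemma pgl_class_carrier:
  fixes a b c d :: int
  assumes "a * d - b * c = 1 \<or> a * d - b * c = - 1"
  shows "pgl_class a b c d \<in> carrier PGL2Z"
proof -
  \<comment> \<open>The inverse is the adjugate matrix times the determinant, which is its own inverse.\<close>
  define s where "s = a * d - b * c"
  have s: "s * (a * d) - s * (b * c) = 1"
    using assms by (auto simp: s_def right_diff_distrib[symmetric])
  have "invertible (vector [vector [a, b], vector [c, d]] :: int ^ 2 ^ 2)"
    unfolding invertible_def
    by (intro exI[of _ "vector [vector [s * d, - s * b], vector [- s * c, s * a]]"] conjI matrix2_eqI)
      (use s in \<open>simp_all add: matrix_matrix_mult_def sum_2 mat_def algebra_simps\<close>)
  then show ?thesis unfolding pgl_class_elems carrier_PGL2Z by blast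
qed

lemma pgl_T_carrier: "pgl_T \<in> carrier PGL2Z"
  unfolding pgl_T_def by (rule pgl_class_carrier) simp

lemma pgl_U_carrier: "pgl_U \<in> carrier PGL2Z"
  unfolding pgl_U_def by (rule pgl_class_carrier) simp

lemma pgl_T_numer_denom:
  obtains s where "s = 1 \<or> s = - 1" "\<And>x. numer pgl_T x = s * (x + 1)" "\<And>x. denom pgl_T x = s"
proof -
  have "rep pgl_T \<in> pgl_class 1 1 0 1" using rep_in[OF pgl_T_carrier] by (simp add: pgl_T_def)
  then consider "rep pgl_T = vector [vector [1, 1], vector [0, 1]]"
    | "rep pgl_T = - vector [vector [1, 1], vector [0, 1]]"
    by (auto simp: pgl_class_elems)
  then show thesis
  proof cases
    case 1
    then show thesis by (intro that[of 1]) (simp_all add: numer_def denom_def)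
  next
    case 2
    then show thesis by (intro that[of "- 1"]) (simp_all add: numer_def denom_def)
  qed
qed

lemma pgl_U_numer_denom:
  obtains s where "s = 1 \<or> s = - 1" "\<And>x. numer pgl_U x = s" "\<And>x. denom pgl_U x = s * x"
proof -
  have "rep pgl_U \<in> pgl_class 0 1 1 0" using rep_in[OF pgl_U_carrier] by (simp add: pgl_U_def)
  then consider "rep pgl_U = vector [vector [0, 1], vector [1, 0]]"
    | "rep pgl_U = - vector [vector [0, 1], vector [1, 0]]"
    by (auto simp: pgl_class_elems)
  then show thesis
  proof cases
    case 1
    then show thesis by (intro that[of 1]) (simp_all add: numer_def denom_def)
  next
    case 2
    then show thesis by (intro that[of "- 1"]) (simp_all add: numer_def denom_def)
  qed
qed

lemma pgl_T_action:
  "moebius pgl_T x = x + 1" "denom pgl_T x \<noteq> 0" "denom pgl_T x ^ (2 * r) = 1"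
proof -
  obtain s where "s = 1 \<or> s = - 1" "\<And>x. numer pgl_T x = s * (x + 1)" "\<And>x. denom pgl_T x = s"
    using pgl_T_numer_denom by blast
  then show "moebius pgl_T x = x + 1" "denom pgl_T x \<noteq> 0" "denom pgl_T x ^ (2 * r) = 1"
    by (auto simp: moebius_def)
qed

lemma pgl_U_action:
  "moebius pgl_U x = 1 / x" "denom pgl_U x = 0 \<longleftrightarrow> x = 0"
  "numer pgl_U x ^ (2 * r) = 1" "denom pgl_U x ^ (2 * r) = x ^ (2 * r)"
proof -
  obtain s where "s = 1 \<or> s = - 1" "\<And>x. numer pgl_U x = s" "\<And>x. denom pgl_U x = s * x"
    using pgl_U_numer_denom by blast
  then show "moebius pgl_U x = 1 / x" "denom pgl_U x = 0 \<longleftrightarrow> x = 0"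
    "numer pgl_U x ^ (2 * r) = 1" "denom pgl_U x ^ (2 * r) = x ^ (2 * r)"
    by (auto simp: moebius_def)
qed

lemma slash_infinity_T:
  assumes P: "initial_assms r P" and \<gamma>: "\<gamma> \<in> carrier PGL2Z"
  shows "slash_infinity r P (\<gamma> \<otimes>\<^bsub>PGL2Z\<^esub> pgl_T) = slash_infinity r P \<gamma>"
proof -
  define B :: "int ^ 2 ^ 2" where "B = vector [vector [1, 1], vector [0, 1]]"
  have B: "B \<in> pgl_T" unfolding pgl_T_def pgl_class_elems B_def by simp
  have "slash_infinity r P (\<gamma> \<otimes>\<^bsub>PGL2Z\<^esub> pgl_T) =
      homog r P (of_int ((rep \<gamma> ** B) $ 1 $ 1)) (of_int ((rep \<gamma> ** B) $ 2 $ 1))"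
    using \<gamma> pgl_T_carrier by (intro slash_elem_homog[OF P] PGL2Z_mult rep_in B) simp_all
  also have "\<dots> = slash_infinity r P \<gamma>"
    by (simp add: slash_elem_homog(2)[OF P \<gamma> rep_in[OF \<gamma>]] matrix_matrix_mult_def sum_2 B_def)
  finally show ?thesis .
qed

lemma signed_slash_T:
  assumes P: "initial_assms r P" and \<gamma>: "\<gamma> \<in> carrier PGL2Z"
  shows "signed_slash r P (\<gamma> \<otimes>\<^bsub>PGL2Z\<^esub> pgl_T) x = signed_slash r P \<gamma> (x + 1)"
  by (simp add: signed_slash_def eps_def slash_infinity_T[OF assms]
      slash_mult[OF P \<gamma> pgl_T_carrier] pgl_T_action)

text \<open>Inversion exchanges 0 and infinity, so the value of the transform by \<open>\<gamma>U\<close> at 0 is the value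
of the transform by \<open>\<gamma>\<close> at infinity. Its product with the sign of \<open>\<gamma>U\<close> is therefore positive
exactly when the two signs \<open>eps\<close> differ.\<close>

lemma signed_slash_U:
  assumes P: "initial_assms r P" and \<gamma>: "\<gamma> \<in> carrier PGL2Z" and x: "x \<noteq> 0"
  shows "x ^ (2 * r) * signed_slash r P \<gamma> (1 / x) =
    (if signed_slash r P (\<gamma> \<otimes>\<^bsub>PGL2Z\<^esub> pgl_U) 0 > 0 then - 1 else 1) *
      signed_slash r P (\<gamma> \<otimes>\<^bsub>PGL2Z\<^esub> pgl_U) x"
proof -
  let ?\<gamma>U = "\<gamma> \<otimes>\<^bsub>PGL2Z\<^esub> pgl_U"
  have at_x: "slash r P ?\<gamma>U x = x ^ (2 * r) * slash r P \<gamma> (1 / x)"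
    using x by (simp add: slash_mult[OF P \<gamma> pgl_U_carrier] pgl_U_action)
  have at_0: "slash r P ?\<gamma>U 0 = slash_infinity r P \<gamma>"
    by (simp add: slash_mult[OF P \<gamma> pgl_U_carrier] pgl_U_action)
  have "eps r P \<gamma> = (if signed_slash r P ?\<gamma>U 0 > 0 then - 1 else 1) * eps r P ?\<gamma>U"
    using slash_infinity_nonzero[OF P \<gamma>]
    by (auto simp: signed_slash_def at_0 eps_def)
  then have "x ^ (2 * r) * signed_slash r P \<gamma> (1 / x) =
      ((if signed_slash r P ?\<gamma>U 0 > 0 then - 1 else 1) * eps r P ?\<gamma>U) * slash r P ?\<gamma>U x"
    unfolding signed_slash_def at_x by (metis mult.left_commute)
  then show ?thesis by (simp add: signed_slash_def mult.assoc)
qed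

section \<open>Weights on cosets\<close>

lemma coset_space_mult:
  assumes C: "C \<in> coset_space r P" and \<sigma>: "\<sigma> \<in> carrier PGL2Z"
  shows "C #>\<^bsub>PGL2Z\<^esub> \<sigma> \<in> coset_space r P"
    and "(C #>\<^bsub>PGL2Z\<^esub> \<sigma>) #>\<^bsub>PGL2Z\<^esub> inv\<^bsub>PGL2Z\<^esub> \<sigma> = C"
    and "(C #>\<^bsub>PGL2Z\<^esub> inv\<^bsub>PGL2Z\<^esub> \<sigma>) #>\<^bsub>PGL2Z\<^esub> \<sigma> = C"
proof -
  have sub: "stab r P \<subseteq> carrier PGL2Z" by (auto simp: stab_def)
  obtain \<gamma> where \<gamma>: "\<gamma> \<in> carrier PGL2Z" "C = stab r P #>\<^bsub>PGL2Z\<^esub> \<gamma>"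
    using C by (auto simp: coset_space_def RCOSETS_def)
  then have "C \<subseteq> carrier PGL2Z" using sub by (simp add: PGL.r_coset_subset_G)
  then show "(C #>\<^bsub>PGL2Z\<^esub> \<sigma>) #>\<^bsub>PGL2Z\<^esub> inv\<^bsub>PGL2Z\<^esub> \<sigma> = C"
    "(C #>\<^bsub>PGL2Z\<^esub> inv\<^bsub>PGL2Z\<^esub> \<sigma>) #>\<^bsub>PGL2Z\<^esub> \<sigma> = C"
    using \<sigma> by (simp_all add: PGL.coset_mult_assoc)
  have "C #>\<^bsub>PGL2Z\<^esub> \<sigma> = stab r P #>\<^bsub>PGL2Z\<^esub> (\<gamma> \<otimes>\<^bsub>PGL2Z\<^esub> \<sigma>)"
    using \<gamma> \<sigma> sub by (simp add: PGL.coset_mult_assoc)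
  then show "C #>\<^bsub>PGL2Z\<^esub> \<sigma> \<in> coset_space r P"
    using \<gamma> \<sigma> unfolding coset_space_def RCOSETS_def by auto
qed

lemma bij_coset_space_mult:
  assumes \<sigma>: "\<sigma> \<in> carrier PGL2Z"
  shows "bij_betw (\<lambda>C. C #>\<^bsub>PGL2Z\<^esub> \<sigma>) (coset_space r P) (coset_space r P)"
  by (rule bij_betw_byWitness[where f' = "\<lambda>C. C #>\<^bsub>PGL2Z\<^esub> inv\<^bsub>PGL2Z\<^esub> \<sigma>"])
    (use coset_space_mult \<sigma> in auto)

lemma coset_space_elem:
  assumes P: "initial_assms r P" and C: "C \<in> coset_space r P"
  obtains \<gamma> where "\<gamma> \<in> C" "\<gamma> \<in> carrier PGL2Z" "C = stab r P #>\<^bsub>PGL2Z\<^esub> \<gamma>"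
  using C PGL.rcos_self[OF _ subgroup_stab[OF P]]
  unfolding coset_space_def RCOSETS_def by blast

lemma coset_fun_mult:
  assumes P: "initial_assms r P" and C: "C \<in> coset_space r P" and \<gamma>: "\<gamma> \<in> C"
    and \<sigma>: "\<sigma> \<in> carrier PGL2Z"
  shows "coset_fun r P (C #>\<^bsub>PGL2Z\<^esub> \<sigma>) = signed_slash r P (\<gamma> \<otimes>\<^bsub>PGL2Z\<^esub> \<sigma>)"
  using \<gamma> by (intro coset_fun_eq[OF P coset_space_mult(1)[OF C \<sigma>]]) (auto simp: r_coset_def)

text \<open>Equivariance of the weights under translation and inversion is stated through inverse group
elements and therefore is used at the translated coset. The sign rule of the family
is \<open>signed_slash_U\<close>.\<close>

lemma inversion_family_coset_weight:
  assumes r: "r \<ge> 1" and P: "initial_assms r P" and w: "coset_weight r P w"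
  shows "inversion_family r (coset_space r P) {C \<in> coset_space r P. coset_fun r P C 0 > 0}
    (\<lambda>C x. w C x * coset_fun r P C x) (\<lambda>C. C #>\<^bsub>PGL2Z\<^esub> pgl_T) (\<lambda>C. C #>\<^bsub>PGL2Z\<^esub> pgl_U)"
proof
  have w_nonneg: "w C x \<ge> 0" if "C \<in> coset_space r P" for C x
    using w that by (auto simp: coset_weight_def)
  have w_mult: "w C (moebius \<sigma> x) = w (C #>\<^bsub>PGL2Z\<^esub> \<sigma>) x"
    if "C \<in> coset_space r P" "\<sigma> \<in> {pgl_T, pgl_U}" "denom \<sigma> x \<noteq> 0" for C \<sigma> x
  proof -
    have \<sigma>: "\<sigma> \<in> carrier PGL2Z" using that pgl_T_carrier pgl_U_carrier by auto
    have "w ((C #>\<^bsub>PGL2Z\<^esub> \<sigma>) #>\<^bsub>PGL2Z\<^esub> inv\<^bsub>PGL2Z\<^esub> \<sigma>) (moebius \<sigma> x) = w (C #>\<^bsub>PGL2Z\<^esub> \<sigma>) x"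
      using w that coset_space_mult(1)[OF that(1) \<sigma>] unfolding coset_weight_def by blast
    then show ?thesis by (simp only: coset_space_mult(2)[OF that(1) \<sigma>])
  qed
  show "r \<ge> 1" by (rule r)
  show "finite {C \<in> coset_space r P. coset_fun r P C 0 > 0}"
    using w by (simp add: coset_weight_def)
  show "{C \<in> coset_space r P. coset_fun r P C 0 > 0} \<subseteq> coset_space r P" by blast
  show "bij_betw (\<lambda>C. C #>\<^bsub>PGL2Z\<^esub> pgl_T) (coset_space r P) (coset_space r P)"
    "bij_betw (\<lambda>C. C #>\<^bsub>PGL2Z\<^esub> pgl_U) (coset_space r P) (coset_space r P)"
    by (intro bij_coset_space_mult pgl_T_carrier pgl_U_carrier)+
  fix C x
  {
    assume "C \<in> {C \<in> coset_space r P. coset_fun r P C 0 > 0}"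
    then show "0 \<le> w C 0 * coset_fun r P C 0" using w_nonneg by simp
  }
  {
    assume "C \<in> coset_space r P - {C \<in> coset_space r P. coset_fun r P C 0 > 0}"
    then show "w C 0 * coset_fun r P C 0 \<le> 0"
      using w_nonneg by (auto intro: mult_nonneg_nonpos)
  }
  assume C: "C \<in> coset_space r P"
  then obtain \<gamma> where \<gamma>: "\<gamma> \<in> C" "\<gamma> \<in> carrier PGL2Z" by (rule coset_space_elem[OF P])
  show "continuous_on UNIV (\<lambda>x. w C x * coset_fun r P C x)"
    using w C by (simp add: coset_weight_def)
  show "w C (x + 1) * coset_fun r P C (x + 1) =
      w (C #>\<^bsub>PGL2Z\<^esub> pgl_T) x * coset_fun r P (C #>\<^bsub>PGL2Z\<^esub> pgl_T) x"
    using w_mult[OF C, of pgl_T x] signed_slash_T[OF P \<gamma>(2), of x]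
    by (simp add: pgl_T_action coset_fun_eq[OF P C \<gamma>(1)] coset_fun_mult[OF P C \<gamma>(1) pgl_T_carrier])
  assume x: "x \<noteq> 0"
  have w_U: "w C (1 / x) = w (C #>\<^bsub>PGL2Z\<^esub> pgl_U) x"
    using w_mult[OF C, of pgl_U x] x by (simp add: pgl_U_action)
  have Z_U: "C #>\<^bsub>PGL2Z\<^esub> pgl_U \<in> {C \<in> coset_space r P. coset_fun r P C 0 > 0} \<longleftrightarrow>
      signed_slash r P (\<gamma> \<otimes>\<^bsub>PGL2Z\<^esub> pgl_U) 0 > 0"
    using coset_space_mult(1)[OF C pgl_U_carrier]
    by (simp add: coset_fun_mult[OF P C \<gamma>(1) pgl_U_carrier])
  have "x ^ (2 * r) * (w C (1 / x) * coset_fun r P C (1 / x)) =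
      w (C #>\<^bsub>PGL2Z\<^esub> pgl_U) x * (x ^ (2 * r) * signed_slash r P \<gamma> (1 / x))"
    by (simp only: w_U coset_fun_eq[OF P C \<gamma>(1)] mult.left_commute)
  then show "x ^ (2 * r) * (w C (1 / x) * coset_fun r P C (1 / x)) =
      (if C #>\<^bsub>PGL2Z\<^esub> pgl_U \<in> {C \<in> coset_space r P. coset_fun r P C 0 > 0} then - 1 else 1) *
      (w (C #>\<^bsub>PGL2Z\<^esub> pgl_U) x * coset_fun r P (C #>\<^bsub>PGL2Z\<^esub> pgl_U) x)"
    unfolding Z_U signed_slash_U[OF P \<gamma>(2) x] coset_fun_mult[OF P C \<gamma>(1) pgl_U_carrier]
    by (simp only: mult.left_commute)
qed

lemma coset_sum_continuous:
  assumes r: "r \<ge> 1" and P: "initial_assms r P" and w: "coset_weight r P w"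
  defines "S \<equiv> \<lambda>x. \<Sum>\<^sub>\<infinity>C\<in>coset_space r P. w C x * max (coset_fun r P C x) 0"
  shows "(\<lambda>C. w C x * max (coset_fun r P C x) 0) summable_on coset_space r P"
    and "S (x + 1) = S x" and "continuous_on UNIV S"
proof -
  interpret F: inversion_family r "coset_space r P" "{C \<in> coset_space r P. coset_fun r P C 0 > 0}"
    "\<lambda>C x. w C x * coset_fun r P C x" "\<lambda>C. C #>\<^bsub>PGL2Z\<^esub> pgl_T" "\<lambda>C. C #>\<^bsub>PGL2Z\<^esub> pgl_U"
    by (rule inversion_family_coset_weight[OF r P w])
  have pos: "F.pos C x = w C x * max (coset_fun r P C x) 0" if "C \<in> coset_space r P" for C x
    using w that max_mult_distrib_left[of "w C x" "coset_fun r P C x" 0]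
    by (auto simp: F.pos_def coset_weight_def)
  have S: "S = F.total"
    unfolding S_def F.total_def fun_eq_iff by (intro allI infsum_cong) (simp add: pos)
  show "(\<lambda>C. w C x * max (coset_fun r P C x) 0) summable_on coset_space r P"
    using F.summable[of x] by (rule summable_on_cong[THEN iffD1, rotated]) (rule pos)
  show "S (x + 1) = S x" "continuous_on UNIV S"
    unfolding S by (rule F.total_periodic F.total_continuous)+
qed

section \<open>Weights on the group\<close>

text \<open>Summation by blocks, with unconditional convergence supplied by nonnegativity.\<close>

lemma summable_on_Union_nonneg:
  fixes f :: "'a \<Rightarrow> real"
  assumes disj: "pairwise disjnt \<C>" and nonneg: "\<And>x. x \<in> \<Union>\<C> \<Longrightarrow> f x \<ge> 0"
    and sum: "\<And>C. C \<in> \<C> \<Longrightarrow> f summable_on C" "(\<lambda>C. infsum f C) summable_on \<C>"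
  shows "f summable_on \<Union>\<C>" and "infsum f (\<Union>\<C>) = (\<Sum>\<^sub>\<infinity>C\<in>\<C>. infsum f C)"
proof -
  have bij: "bij_betw snd (Sigma \<C> (\<lambda>C. C)) (\<Union>\<C>)"
  proof (rule bij_betw_imageI)
    show "inj_on snd (Sigma \<C> (\<lambda>C. C))"
    proof (rule inj_onI)
      fix p q assume pq: "p \<in> Sigma \<C> (\<lambda>C. C)" "q \<in> Sigma \<C> (\<lambda>C. C)" "snd p = snd q"
      then have "fst p \<in> \<C>" "fst q \<in> \<C>" "snd p \<in> fst p \<inter> fst q" by auto
      then have "fst p = fst q" using pairwiseD[OF disj] unfolding disjnt_def by blast
      with pq(3) show "p = q" by (rule prod_eqI[rotated])
    qed
    show "snd ` Sigma \<C> (\<lambda>C. C) = \<Union>\<C>" by force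
  qed
  have norm: "(\<Sum>\<^sub>\<infinity>y\<in>C. norm (f y)) = infsum f C" if "C \<in> \<C>" for C
    by (intro infsum_cong) (use nonneg[OF UnionI[OF that]] in simp)
  have "(\<lambda>p. norm (f (snd p))) summable_on Sigma \<C> (\<lambda>C. C)"
    unfolding Infinite_Sum.abs_summable_on_Sigma_iff
  proof (intro conjI ballI)
    fix C assume C: "C \<in> \<C>"
    then have "(\<lambda>y. norm (f y)) summable_on C"
      by (intro summable_on_iff_abs_summable_on_real[THEN iffD1] sum(1))
    then show "(\<lambda>y. norm (f (snd (C, y)))) summable_on C" by simp
  next
    have "norm (\<Sum>\<^sub>\<infinity>y\<in>C. norm (f (snd (C, y)))) = infsum f C" if "C \<in> \<C>" for C
      using norm[OF that] nonneg that by (auto intro!: abs_of_nonneg infsum_nonneg)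
    then show "(\<lambda>C. norm (\<Sum>\<^sub>\<infinity>y\<in>C. norm (f (snd (C, y))))) summable_on \<C>"
      using sum(2) by (subst summable_on_cong[where g = "infsum f"]) auto
  qed
  then have Sigma: "(\<lambda>p. f (snd p)) summable_on Sigma \<C> (\<lambda>C. C)"
    by (rule Infinite_Sum.abs_summable_summable)
  then show "f summable_on \<Union>\<C>"
    using summable_on_reindex_bij_betw[OF bij, of f] by simp
  have "infsum f (\<Union>\<C>) = infsum (\<lambda>p. f (snd p)) (Sigma \<C> (\<lambda>C. C))"
    using infsum_reindex_bij_betw[OF bij, of f] by simp
  also have "\<dots> = (\<Sum>\<^sub>\<infinity>C\<in>\<C>. infsum f C)"
    using infsum_Sigma_banach[OF Sigma] by simp
  finally show "infsum f (\<Union>\<C>) = (\<Sum>\<^sub>\<infinity>C\<in>\<C>. infsum f C)" .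
qed

text \<open>Where the function of the coset vanishes, the sum may diverge and then has the value 0 by
convention. This is harmless because only the product with that function matters.\<close>

definition coset_sum :: "((int ^ 2 ^ 2) set \<Rightarrow> real \<Rightarrow> real) \<Rightarrow> (int ^ 2 ^ 2) set set \<Rightarrow> real \<Rightarrow> real" where
  "coset_sum w C x = (\<Sum>\<^sub>\<infinity>\<gamma>\<in>C. w \<gamma> x)"

lemma bij_right_mult:
  assumes "\<gamma> \<in> carrier PGL2Z" and "C \<subseteq> carrier PGL2Z"
  shows "bij_betw (\<lambda>\<delta>. \<delta> \<otimes>\<^bsub>PGL2Z\<^esub> \<gamma>) C (C #>\<^bsub>PGL2Z\<^esub> \<gamma>)"
  using assms by (auto simp: bij_betw_def inj_on_def r_coset_def subset_iff)

text \<open>The summability condition speaks of the absolute value of the transform. Exchanging the absolute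
value for the transform itself leaves all distances between partial sums unchanged, so the signed
sums converge uniformly too, and their terms are continuous because the transform is the same for
all elements of the coset.\<close>

lemma group_weight_local_sum:
  assumes P: "initial_assms r P" and w: "group_weight r P w"
    and \<gamma>: "\<gamma> \<in> carrier PGL2Z" and C: "C = stab r P #>\<^bsub>PGL2Z\<^esub> \<gamma>"
  shows "signed_slash r P \<gamma> x \<noteq> 0 \<Longrightarrow> (\<lambda>\<gamma>. w \<gamma> x) summable_on C"
    and "continuous_on UNIV (\<lambda>x. coset_sum w C x * signed_slash r P \<gamma> x)"
proof -
  let ?s = "signed_slash r P \<gamma>"
  define f where "f \<delta> x = w (\<delta> \<otimes>\<^bsub>PGL2Z\<^esub> \<gamma>) x * \<bar>?s x\<bar>" for \<delta> x
  have "\<bar>?s x\<bar> = \<bar>slash r P \<gamma> x\<bar>" for x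
    by (simp add: signed_slash_def eps_def)
  then have "locally_uniformly_summable f (stab r P)"
    using w \<gamma> unfolding group_weight_def f_def by simp
  then have loc: "\<exists>N l. open N \<and> x \<in> N \<and>
      uniform_limit N (\<lambda>F y. \<Sum>\<delta>\<in>F. f \<delta> y) l (finite_subsets_at_top (stab r P))" for x
    unfolding locally_uniformly_summable_def by metis
  have bij: "bij_betw (\<lambda>\<delta>. \<delta> \<otimes>\<^bsub>PGL2Z\<^esub> \<gamma>) (stab r P) C"
    unfolding C by (rule bij_right_mult[OF \<gamma>]) (auto simp: stab_def)
  have has_sum: "((\<lambda>\<delta>. f \<delta> y) has_sum l y) (stab r P)"
    if "uniform_limit N (\<lambda>F y. \<Sum>\<delta>\<in>F. f \<delta> y) l (finite_subsets_at_top (stab r P))" "y \<in> N" for N l y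
    using tendsto_uniform_limitI[OF that] by (simp add: has_sum_def)
  have l_eq: "l y = coset_sum w C y * \<bar>?s y\<bar>"
    if "uniform_limit N (\<lambda>F y. \<Sum>\<delta>\<in>F. f \<delta> y) l (finite_subsets_at_top (stab r P))" "y \<in> N" for N l y
  proof -
    have "l y = (\<Sum>\<^sub>\<infinity>\<delta>\<in>stab r P. f \<delta> y)" using has_sum[OF that] by (simp add: infsumI)
    also have "\<dots> = (\<Sum>\<^sub>\<infinity>\<delta>\<in>stab r P. w (\<delta> \<otimes>\<^bsub>PGL2Z\<^esub> \<gamma>) y) * \<bar>?s y\<bar>"
      unfolding f_def by (rule infsum_cmult_left')
    also have "(\<Sum>\<^sub>\<infinity>\<delta>\<in>stab r P. w (\<delta> \<otimes>\<^bsub>PGL2Z\<^esub> \<gamma>) y) = coset_sum w C y"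
      unfolding coset_sum_def by (rule infsum_reindex_bij_betw[OF bij])
    finally show ?thesis .
  qed
  {
    assume nz: "?s x \<noteq> 0"
    obtain N l where N: "x \<in> N"
      "uniform_limit N (\<lambda>F y. \<Sum>\<delta>\<in>F. f \<delta> y) l (finite_subsets_at_top (stab r P))"
      using loc[of x] by blast
    have "(\<lambda>\<delta>. f \<delta> x) summable_on stab r P"
      using has_sum[OF N(2,1)] by (auto simp: summable_on_def)
    then have "(\<lambda>\<delta>. w (\<delta> \<otimes>\<^bsub>PGL2Z\<^esub> \<gamma>) x) summable_on stab r P"
      unfolding f_def using nz by (simp add: summable_on_cmult_left')
    then show "(\<lambda>\<gamma>. w \<gamma> x) summable_on C"
      using summable_on_reindex_bij_betw[OF bij, of "\<lambda>\<gamma>. w \<gamma> x"] by simp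
  }
  have "isCont (\<lambda>x. coset_sum w C x * ?s x) x" for x
  proof -
    obtain N l where N: "open N" "x \<in> N"
      "uniform_limit N (\<lambda>F y. \<Sum>\<delta>\<in>F. f \<delta> y) l (finite_subsets_at_top (stab r P))"
      using loc[of x] by blast
    have "uniform_limit N (\<lambda>F y. \<Sum>\<delta>\<in>F. w (\<delta> \<otimes>\<^bsub>PGL2Z\<^esub> \<gamma>) y * ?s y)
        (\<lambda>y. coset_sum w C y * ?s y) (finite_subsets_at_top (stab r P))"
    proof (rule uniform_limitI)
      fix e :: real assume "e > 0"
      have "\<forall>\<^sub>F F in finite_subsets_at_top (stab r P). \<forall>y\<in>N. dist (\<Sum>\<delta>\<in>F. f \<delta> y) (l y) < e"
        using N(3) \<open>e > 0\<close> by (rule uniform_limitD)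
      then show "\<forall>\<^sub>F F in finite_subsets_at_top (stab r P). \<forall>y\<in>N.
          dist (\<Sum>\<delta>\<in>F. w (\<delta> \<otimes>\<^bsub>PGL2Z\<^esub> \<gamma>) y * ?s y) (coset_sum w C y * ?s y) < e"
      proof eventually_elim
        case (elim F)
        show ?case
        proof
          fix y assume y: "y \<in> N"
          have "dist (\<Sum>\<delta>\<in>F. w (\<delta> \<otimes>\<^bsub>PGL2Z\<^esub> \<gamma>) y * ?s y) (coset_sum w C y * ?s y) =
              dist (\<Sum>\<delta>\<in>F. f \<delta> y) (l y)"
            by (simp add: f_def l_eq[OF N(3) y] dist_real_def abs_mult
                flip: sum_distrib_right left_diff_distrib)
          then show "dist (\<Sum>\<delta>\<in>F. w (\<delta> \<otimes>\<^bsub>PGL2Z\<^esub> \<gamma>) y * ?s y) (coset_sum w C y * ?s y) < e"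
            using elim y by simp
        qed
      qed
    qed
    moreover have "\<forall>\<^sub>F F in finite_subsets_at_top (stab r P).
        continuous_on N (\<lambda>y. \<Sum>\<delta>\<in>F. w (\<delta> \<otimes>\<^bsub>PGL2Z\<^esub> \<gamma>) y * ?s y)"
    proof (rule eventually_finite_subsets_at_top_weakI)
      fix F assume F: "finite F" "F \<subseteq> stab r P"
      show "continuous_on N (\<lambda>y. \<Sum>\<delta>\<in>F. w (\<delta> \<otimes>\<^bsub>PGL2Z\<^esub> \<gamma>) y * ?s y)"
      proof (rule continuous_on_sum)
        fix \<delta> assume "\<delta> \<in> F"
        then have \<delta>: "\<delta> \<in> stab r P" "\<delta> \<otimes>\<^bsub>PGL2Z\<^esub> \<gamma> \<in> carrier PGL2Z"
          using F \<gamma> by (auto simp: stab_def)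
        have "continuous_on UNIV (\<lambda>y. w (\<delta> \<otimes>\<^bsub>PGL2Z\<^esub> \<gamma>) y * signed_slash r P (\<delta> \<otimes>\<^bsub>PGL2Z\<^esub> \<gamma>) y)"
          using w \<delta>(2) by (simp add: group_weight_def)
        then show "continuous_on N (\<lambda>y. w (\<delta> \<otimes>\<^bsub>PGL2Z\<^esub> \<gamma>) y * ?s y)"
          unfolding signed_slash_stab_mult[OF P \<delta>(1) \<gamma>] by (rule continuous_on_subset) simp
      qed
    qed
    ultimately have "continuous_on N (\<lambda>y. coset_sum w C y * ?s y)"
      by (intro uniform_limit_theorem[OF _ _ finite_subsets_at_top_neq_bot])
    then show ?thesis using N(1,2) by (simp add: continuous_on_eq_continuous_at)
  qed
  then show "continuous_on UNIV (\<lambda>x. coset_sum w C x * ?s x)"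
    by (simp add: continuous_on_eq_continuous_at)
qed

lemma coset_weight_coset_sum:
  assumes P: "initial_assms r P" and w: "group_weight r P w"
  shows "coset_weight r P (coset_sum w)"
  unfolding coset_weight_def
proof (intro conjI ballI allI impI)
  have sub: "C \<subseteq> carrier PGL2Z" if "C \<in> coset_space r P" for C
    using that PGL.rcosets_part_G[OF subgroup_stab[OF P]] unfolding coset_space_def by blast
  {
    fix C x assume "C \<in> coset_space r P"
    then show "coset_sum w C x \<ge> 0"
      unfolding coset_sum_def using w sub by (intro infsum_nonneg) (auto simp: group_weight_def)
  }
  {
    fix \<sigma> C x assume \<sigma>: "\<sigma> \<in> {pgl_T, pgl_V, pgl_U}" and C: "C \<in> coset_space r P"
      and x: "denom \<sigma> x \<noteq> 0"
    have \<sigma>_carrier: "\<sigma> \<in> carrier PGL2Z"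
      using \<sigma> by (auto simp: pgl_T_def pgl_V_def pgl_U_def intro!: pgl_class_carrier)
    have "coset_sum w (C #>\<^bsub>PGL2Z\<^esub> inv\<^bsub>PGL2Z\<^esub> \<sigma>) (moebius \<sigma> x) =
        (\<Sum>\<^sub>\<infinity>\<gamma>\<in>C. w (\<gamma> \<otimes>\<^bsub>PGL2Z\<^esub> inv\<^bsub>PGL2Z\<^esub> \<sigma>) (moebius \<sigma> x))"
      unfolding coset_sum_def using \<sigma>_carrier
      by (intro infsum_reindex_bij_betw[symmetric] bij_right_mult sub[OF C]) simp
    also have "\<dots> = coset_sum w C x"
      unfolding coset_sum_def using w \<sigma> x sub[OF C]
      by (intro infsum_cong) (auto simp: group_weight_def)
    finally show "coset_sum w (C #>\<^bsub>PGL2Z\<^esub> inv\<^bsub>PGL2Z\<^esub> \<sigma>) (moebius \<sigma> x) = coset_sum w C x" .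
  }
  {
    fix C assume C: "C \<in> coset_space r P"
    then obtain \<gamma> where \<gamma>: "\<gamma> \<in> C" "\<gamma> \<in> carrier PGL2Z" "C = stab r P #>\<^bsub>PGL2Z\<^esub> \<gamma>"
      by (rule coset_space_elem[OF P])
    show "continuous_on UNIV (\<lambda>x. coset_sum w C x * coset_fun r P C x)"
      unfolding coset_fun_eq[OF P C \<gamma>(1)] by (rule group_weight_local_sum[OF P w \<gamma>(2,3)])
  }
  have "{C \<in> coset_space r P. coset_fun r P C 0 > 0} \<subseteq>
      {stab r P #>\<^bsub>PGL2Z\<^esub> \<gamma> | \<gamma>. \<gamma> \<in> carrier PGL2Z \<and> signed_slash r P \<gamma> 0 > 0}"
  proof
    fix C assume "C \<in> {C \<in> coset_space r P. coset_fun r P C 0 > 0}"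
    then have C: "C \<in> coset_space r P" "coset_fun r P C 0 > 0" by simp_all
    from C(1) obtain \<gamma> where \<gamma>: "\<gamma> \<in> C" "\<gamma> \<in> carrier PGL2Z" "C = stab r P #>\<^bsub>PGL2Z\<^esub> \<gamma>"
      by (rule coset_space_elem[OF P])
    then show "C \<in> {stab r P #>\<^bsub>PGL2Z\<^esub> \<gamma> | \<gamma>. \<gamma> \<in> carrier PGL2Z \<and> signed_slash r P \<gamma> 0 > 0}"
      using C(2) coset_fun_eq[OF P C(1) \<gamma>(1)] by auto
  qed
  then show "finite {C \<in> coset_space r P. coset_fun r P C 0 > 0}"
    using w unfolding group_weight_def by (blast intro: finite_subset)
qed

lemma group_sum_eq_coset_sum:
  assumes r: "r \<ge> 1" and P: "initial_assms r P" and w: "group_weight r P w"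
  shows "(\<lambda>\<gamma>. w \<gamma> x * max (signed_slash r P \<gamma> x) 0) summable_on carrier PGL2Z"
    and "(\<Sum>\<^sub>\<infinity>\<gamma>\<in>carrier PGL2Z. w \<gamma> x * max (signed_slash r P \<gamma> x) 0) =
      (\<Sum>\<^sub>\<infinity>C\<in>coset_space r P. coset_sum w C x * max (coset_fun r P C x) 0)"
proof -
  let ?f = "\<lambda>\<gamma>. w \<gamma> x * max (signed_slash r P \<gamma> x) 0"
  have part: "\<Union>(coset_space r P) = carrier PGL2Z"
    unfolding coset_space_def by (rule PGL.rcosets_part_G[OF subgroup_stab[OF P]])
  have disj: "pairwise disjnt (coset_space r P)"
    unfolding coset_space_def by (rule PGL.rcos_disjoint[OF subgroup_stab[OF P]])
  have nonneg: "?f \<gamma> \<ge> 0" if "\<gamma> \<in> \<Union>(coset_space r P)" for \<gamma>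
    using w that unfolding part by (simp add: group_weight_def)
  have const: "?f \<gamma> = w \<gamma> x * max (coset_fun r P C x) 0" if "C \<in> coset_space r P" "\<gamma> \<in> C" for C \<gamma>
    using coset_fun_eq[OF P that] by simp
  have summable_C: "?f summable_on C" if C: "C \<in> coset_space r P" for C
  proof (cases "coset_fun r P C x = 0")
    case True
    then have "?f \<gamma> = 0" if "\<gamma> \<in> C" for \<gamma> using const[OF C that] by simp
    then show ?thesis by (rule summable_on_0)
  next
    case False
    obtain \<gamma> where \<gamma>: "\<gamma> \<in> C" "\<gamma> \<in> carrier PGL2Z" "C = stab r P #>\<^bsub>PGL2Z\<^esub> \<gamma>"
      using C by (rule coset_space_elem[OF P])
    have "(\<lambda>\<gamma>. w \<gamma> x) summable_on C"
      using False coset_fun_eq[OF P C \<gamma>(1)]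
      by (intro group_weight_local_sum(1)[OF P w \<gamma>(2,3)]) simp
    then have "(\<lambda>\<gamma>. w \<gamma> x * max (coset_fun r P C x) 0) summable_on C"
      by (rule summable_on_cmult_left)
    then show ?thesis by (rule summable_on_cong[THEN iffD2, rotated]) (rule const[OF C])
  qed
  have infsum_C: "infsum ?f C = coset_sum w C x * max (coset_fun r P C x) 0"
    if C: "C \<in> coset_space r P" for C
  proof -
    have "infsum ?f C = (\<Sum>\<^sub>\<infinity>\<gamma>\<in>C. w \<gamma> x * max (coset_fun r P C x) 0)"
      by (intro infsum_cong const[OF C])
    then show ?thesis unfolding coset_sum_def by (simp only: infsum_cmult_left')
  qed
  have summable: "(\<lambda>C. infsum ?f C) summable_on coset_space r P"
    using coset_sum_continuous(1)[OF r P coset_weight_coset_sum[OF P w], of x]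
    by (rule summable_on_cong[THEN iffD2, rotated]) (rule infsum_C)
  show "?f summable_on carrier PGL2Z"
    using summable_on_Union_nonneg(1)[OF disj nonneg summable_C summable] unfolding part .
  have "infsum ?f (carrier PGL2Z) = (\<Sum>\<^sub>\<infinity>C\<in>coset_space r P. infsum ?f C)"
    using summable_on_Union_nonneg(2)[OF disj nonneg summable_C summable] unfolding part .
  also have "\<dots> = (\<Sum>\<^sub>\<infinity>C\<in>coset_space r P. coset_sum w C x * max (coset_fun r P C x) 0)"
    by (intro infsum_cong infsum_C)
  finally show "infsum ?f (carrier PGL2Z) =
      (\<Sum>\<^sub>\<infinity>C\<in>coset_space r P. coset_sum w C x * max (coset_fun r P C x) 0)" .
qed

theorem mainTheorem4:
  fixes r :: nat and \<P> :: "(real \<Rightarrow> real) set"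
  assumes "r \<ge> 1"
    and "finite \<P>"
    and "\<And>P. P \<in> \<P> \<Longrightarrow> initial_assms r P"
    and "\<And>P\<^sub>1 P\<^sub>2 \<gamma>\<^sub>1 \<gamma>\<^sub>2. P\<^sub>1 \<in> \<P> \<Longrightarrow> P\<^sub>2 \<in> \<P> \<Longrightarrow> P\<^sub>1 \<noteq> P\<^sub>2 \<Longrightarrow>
           \<gamma>\<^sub>1 \<in> carrier PGL2Z \<Longrightarrow> \<gamma>\<^sub>2 \<in> carrier PGL2Z \<Longrightarrow>
           signed_slash r P\<^sub>1 \<gamma>\<^sub>1 \<noteq> signed_slash r P\<^sub>2 \<gamma>\<^sub>2"
  shows "(\<forall>w :: (real \<Rightarrow> real) \<Rightarrow> (int ^ 2 ^ 2) set \<Rightarrow> real \<Rightarrow> real.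
            (\<forall>P\<in>\<P>. group_weight r P (w P)) \<longrightarrow>
            (let T = (\<lambda>x. \<Sum>P\<in>\<P>. \<Sum>\<^sub>\<infinity>\<gamma>\<in>carrier PGL2Z. w P \<gamma> x * max (signed_slash r P \<gamma> x) 0)
             in (\<forall>P\<in>\<P>. \<forall>x. (\<lambda>\<gamma>. w P \<gamma> x * max (signed_slash r P \<gamma> x) 0) summable_on carrier PGL2Z) \<and>
                (\<forall>x. T (x + 1) = T x) \<and> continuous_on UNIV T)) \<and>
         (\<forall>w :: (real \<Rightarrow> real) \<Rightarrow> (int ^ 2 ^ 2) set set \<Rightarrow> real \<Rightarrow> real.
            (\<forall>P\<in>\<P>. coset_weight r P (w P)) \<longrightarrow>
            (let T = (\<lambda>x. \<Sum>P\<in>\<P>. \<Sum>\<^sub>\<infinity>C\<in>coset_space r P. w P C x * max (coset_fun r P C x) 0)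
             in (\<forall>P\<in>\<P>. \<forall>x. (\<lambda>C. w P C x * max (coset_fun r P C x) 0) summable_on coset_space r P) \<and>
                (\<forall>x. T (x + 1) = T x) \<and> continuous_on UNIV T))"
proof (intro conjI allI impI; unfold Let_def; intro conjI ballI allI)
  note r = assms(1) and init = assms(3)
  {
    fix w :: "(real \<Rightarrow> real) \<Rightarrow> (int ^ 2 ^ 2) set \<Rightarrow> real \<Rightarrow> real"
    assume "\<forall>P\<in>\<P>. group_weight r P (w P)"
    then have w: "group_weight r P (w P)" if "P \<in> \<P>" for P using that by blast
    note cw = coset_weight_coset_sum[OF init w]
    have eq: "(\<Sum>P\<in>\<P>. \<Sum>\<^sub>\<infinity>\<gamma>\<in>carrier PGL2Z. w P \<gamma> x * max (signed_slash r P \<gamma> x) 0) =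
        (\<Sum>P\<in>\<P>. \<Sum>\<^sub>\<infinity>C\<in>coset_space r P. coset_sum (w P) C x * max (coset_fun r P C x) 0)" for x
      by (intro sum.cong refl group_sum_eq_coset_sum(2)[OF r init w])
    show "(\<lambda>\<gamma>. w P \<gamma> x * max (signed_slash r P \<gamma> x) 0) summable_on carrier PGL2Z"
      if "P \<in> \<P>" for P x
      by (rule group_sum_eq_coset_sum(1)[OF r init[OF that] w[OF that]])
    show "(\<Sum>P\<in>\<P>. \<Sum>\<^sub>\<infinity>\<gamma>\<in>carrier PGL2Z. w P \<gamma> (x + 1) * max (signed_slash r P \<gamma> (x + 1)) 0) =
        (\<Sum>P\<in>\<P>. \<Sum>\<^sub>\<infinity>\<gamma>\<in>carrier PGL2Z. w P \<gamma> x * max (signed_slash r P \<gamma> x) 0)" for x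
      unfolding eq by (intro sum.cong refl coset_sum_continuous(2)[OF r init cw])
    show "continuous_on UNIV (\<lambda>x. \<Sum>P\<in>\<P>. \<Sum>\<^sub>\<infinity>\<gamma>\<in>carrier PGL2Z. w P \<gamma> x * max (signed_slash r P \<gamma> x) 0)"
      unfolding eq by (intro continuous_on_sum coset_sum_continuous(3)[OF r init cw])
  }
  fix w :: "(real \<Rightarrow> real) \<Rightarrow> (int ^ 2 ^ 2) set set \<Rightarrow> real \<Rightarrow> real"
  assume "\<forall>P\<in>\<P>. coset_weight r P (w P)"
  then have w: "coset_weight r P (w P)" if "P \<in> \<P>" for P using that by blast
  show "(\<lambda>C. w P C x * max (coset_fun r P C x) 0) summable_on coset_space r P"
    if "P \<in> \<P>" for P x
    by (rule coset_sum_continuous(1)[OF r init[OF that] w[OF that]])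
  show "(\<Sum>P\<in>\<P>. \<Sum>\<^sub>\<infinity>C\<in>coset_space r P. w P C (x + 1) * max (coset_fun r P C (x + 1)) 0) =
      (\<Sum>P\<in>\<P>. \<Sum>\<^sub>\<infinity>C\<in>coset_space r P. w P C x * max (coset_fun r P C x) 0)" for x
    by (intro sum.cong refl coset_sum_continuous(2)[OF r init w])
  show "continuous_on UNIV (\<lambda>x. \<Sum>P\<in>\<P>. \<Sum>\<^sub>\<infinity>C\<in>coset_space r P. w P C x * max (coset_fun r P C x) 0)"
    by (intro continuous_on_sum coset_sum_continuous(3)[OF r init w])
qed

end
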